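(* Let $(\check{\mathfrak g},J,\omega)$ be a pseudo-Kähler nilpotent Lie algebra with metric $\check g$, let $\check D$ be a derivation of $\check{\mathfrak g}$ and $\tau=\pm1$. Assume that $[J,\check D]=0$ and that $[\check D^s,\check D^a]=h\check D^s-2(\check D^s)^2$ for some constant $h$. Let $\mathfrak g=\check{\mathfrak g}\oplus\mathrm{Span}\{b,\xi\}$ be the central extension of $\check{\mathfrak g}$, with the metric $g$ satisfying, for $x,y\in\check{\mathfrak g}$, \[g(x,y)=\check g(x,y),\quad g(x,b)=g(x,\xi)=0,\quad g(\xi,\xi)=1,\quad g(b,b)=\tau,\quad g(b,\xi)=0,\] determined by $d\xi^\flat=2\omega$ and $db^\flat=\check D\omega$ (right-hand sides pulled back to $\mathfrak g$). Let $\widetilde{\mathfrak g}=\mathfrak g\rtimes_D\mathrm{Span}\{e_0\}$, where $D=\mathrm{ad}\,e_0|_{\mathfrak g}$ is the derivation of $\mathfrak g$ given by \[[e_0,x]=\check Dx\ (x\in\check{\mathfrak g}),\qquad [e_0,b]=hb-2\tau\xi,\qquad [e_0,\xi]=0.\] Then the metric $\widetilde g=g+\tau e^0\otimes e^0$ on $\widetilde{\mathfrak g}$ is Einstein if and only if \[\tau=-1,\qquad \check D^s=\pm\mathrm{Id},\qquad h=\pm2,\] where the two signs $\pm$ are the same.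
   Context: Lie algebras are real and finite-dimensional. A metric on a Lie algebra is a nondegenerate symmetric bilinear form of any signature; its Ricci tensor is that of the corresponding left-invariant metric on a Lie group; Einstein means $\mathrm{ric}=\lambda g$ for a constant $\lambda$. For a one-form $\alpha$, $d\alpha(x,y)=-\alpha([x,y])$, and $v^\flat=g(v,\cdot)$. The form $e^0$ satisfies $e^0(e_0)=1$, $e^0|_{\mathfrak g}=0$. A pseudo-Kähler structure on a Lie algebra consists of a metric $\check g$, an endomorphism $J$ with $J^2=-\mathrm{Id}$, vanishing Nijenhuis tensor and $\check g(JX,JY)=\check g(X,Y)$, and the two-form $\omega(X,Y)=\check g(X,JY)$, which is required to be closed. For an endomorphism $f$, $f^s=\frac12(f+f^* )$ and $f^a=\frac12(f-f^* )$, with $f^*$ the metric adjoint. $\check D$ acts on two-forms by $(\check D\omega)(x,y)=-\omega(\check Dx,y)-\omega(x,\check Dy)$. In the central extension $b,\xi$ are central and, for $x,y\in\check{\mathfrak g}$, $[x,y]_{\mathfrak g}=[x,y]_{\check{\mathfrak g}}-\tau(\check D\omega)(x,y)\,b-2\omega(x,y)\,\xi$, consistent with $d\xi^\flat=2\omega$, $db^\flat=\check D\omega$. Under the stated hypotheses $\widetilde{\mathfrak g}$ is a well-defined Lie algebra. *)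

theory Defs
  imports "HOL-Analysis.Analysis"
begin

section \<open>Finite-dimensional real vector spaces\<close>

text \<open>
  Vector spaces are types of class \<open>real_vector\<close> with a finite spanning set; unlike
  \<open>euclidean_space\<close>, this does not single out an inner product and admits dimension 0.
\<close>

definition finite_dim :: "'v::real_vector itself \<Rightarrow> bool" where
  "finite_dim _ \<longleftrightarrow> (\<exists>B::'v set. finite B \<and> span B = UNIV)"

definition lin_trace :: "('v::real_vector \<Rightarrow> 'v) \<Rightarrow> real" where
  "lin_trace f =
    (let B = (SOME B. independent B \<and> span B = UNIV) in \<Sum>b\<in>B. representation B (f b) b)"


section \<open>Lie algebras\<close>

definition lie_algebra :: "('v::real_vector \<Rightarrow> 'v \<Rightarrow> 'v) \<Rightarrow> bool" where
  "lie_algebra br \<longleftrightarrow>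
     finite_dim TYPE('v) \<and> bilinear br \<and> (\<forall>x. br x x = 0) \<and>
     (\<forall>x y z. br x (br y z) + br y (br z x) + br z (br x y) = 0)"

fun lower_central :: "('v::real_vector \<Rightarrow> 'v \<Rightarrow> 'v) \<Rightarrow> nat \<Rightarrow> 'v set" where
  "lower_central br 0 = UNIV"
| "lower_central br (Suc n) = span {br x y | x y. y \<in> lower_central br n}"

definition nilpotent :: "('v::real_vector \<Rightarrow> 'v \<Rightarrow> 'v) \<Rightarrow> bool" where
  "nilpotent br \<longleftrightarrow> (\<exists>n. lower_central br n = {0})"

definition derivation :: "('v::real_vector \<Rightarrow> 'v \<Rightarrow> 'v) \<Rightarrow> ('v \<Rightarrow> 'v) \<Rightarrow> bool" where
  "derivation br D \<longleftrightarrow> linear D \<and> (\<forall>x y. D (br x y) = br (D x) y + br x (D y))"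

definition d1 :: "('v \<Rightarrow> 'v \<Rightarrow> 'v) \<Rightarrow> ('v \<Rightarrow> real) \<Rightarrow> 'v \<Rightarrow> 'v \<Rightarrow> real" where
  "d1 br \<alpha> x y = - \<alpha> (br x y)"

definition d2 :: "('v \<Rightarrow> 'v \<Rightarrow> 'v) \<Rightarrow> ('v \<Rightarrow> 'v \<Rightarrow> real) \<Rightarrow> 'v \<Rightarrow> 'v \<Rightarrow> 'v \<Rightarrow> real" where
  "d2 br \<omega> x y z = - \<omega> (br x y) z + \<omega> (br x z) y - \<omega> (br y z) x"

definition act2 :: "('v \<Rightarrow> 'v) \<Rightarrow> ('v \<Rightarrow> 'v \<Rightarrow> real) \<Rightarrow> 'v \<Rightarrow> 'v \<Rightarrow> real" where
  "act2 D \<omega> x y = - \<omega> (D x) y - \<omega> x (D y)"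


section \<open>Metrics\<close>

definition lie_metric :: "('v::real_vector \<Rightarrow> 'v \<Rightarrow> real) \<Rightarrow> bool" where
  "lie_metric g \<longleftrightarrow>
     bilinear g \<and> (\<forall>x y. g x y = g y x) \<and> (\<forall>x. (\<forall>y. g x y = 0) \<longrightarrow> x = 0)"

definition flat :: "('v \<Rightarrow> 'v \<Rightarrow> real) \<Rightarrow> 'v \<Rightarrow> 'v \<Rightarrow> real" where
  "flat g v = (\<lambda>w. g v w)"

definition metric_adjoint :: "('v \<Rightarrow> 'v \<Rightarrow> real) \<Rightarrow> ('v \<Rightarrow> 'v) \<Rightarrow> 'v \<Rightarrow> 'v" where
  "metric_adjoint g f = (THE f'. \<forall>x y. g (f' x) y = g x (f y))"

definition sym_part :: "('v::real_vector \<Rightarrow> 'v \<Rightarrow> real) \<Rightarrow> ('v \<Rightarrow> 'v) \<Rightarrow> 'v \<Rightarrow> 'v" where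
  "sym_part g f x = (1/2) *\<^sub>R (f x + metric_adjoint g f x)"

definition skew_part :: "('v::real_vector \<Rightarrow> 'v \<Rightarrow> real) \<Rightarrow> ('v \<Rightarrow> 'v) \<Rightarrow> 'v \<Rightarrow> 'v" where
  "skew_part g f x = (1/2) *\<^sub>R (f x - metric_adjoint g f x)"

text \<open>
  The Levi-Civita connection, curvature and Ricci tensor of the left-invariant metric on a
  Lie group with the given Lie algebra, evaluated on left-invariant vector fields.  There the
  functions \<open>g x y\<close> are constant, so metric compatibility says that each \<open>nabla x\<close> is skew.
\<close>

definition levi_civita ::
    "('v::real_vector \<Rightarrow> 'v \<Rightarrow> 'v) \<Rightarrow> ('v \<Rightarrow> 'v \<Rightarrow> real) \<Rightarrow> 'v \<Rightarrow> 'v \<Rightarrow> 'v" where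
  "levi_civita br g =
     (THE nabla. bilinear nabla \<and>
        (\<forall>x y. nabla x y - nabla y x = br x y) \<and>
        (\<forall>x y z. g (nabla x y) z + g y (nabla x z) = 0))"

definition curvature ::
    "('v::real_vector \<Rightarrow> 'v \<Rightarrow> 'v) \<Rightarrow> ('v \<Rightarrow> 'v \<Rightarrow> real) \<Rightarrow> 'v \<Rightarrow> 'v \<Rightarrow> 'v \<Rightarrow> 'v" where
  "curvature br g x y z =
     (let nabla = levi_civita br g
      in nabla x (nabla y z) - nabla y (nabla x z) - nabla (br x y) z)"

definition ricci ::
    "('v::real_vector \<Rightarrow> 'v \<Rightarrow> 'v) \<Rightarrow> ('v \<Rightarrow> 'v \<Rightarrow> real) \<Rightarrow> 'v \<Rightarrow> 'v \<Rightarrow> real" where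
  "ricci br g y z = lin_trace (\<lambda>x. curvature br g x y z)"

definition einstein :: "('v::real_vector \<Rightarrow> 'v \<Rightarrow> 'v) \<Rightarrow> ('v \<Rightarrow> 'v \<Rightarrow> real) \<Rightarrow> bool" where
  "einstein br g \<longleftrightarrow> (\<exists>c. \<forall>x y. ricci br g x y = c * g x y)"


section \<open>Pseudo-Kaehler structures\<close>

definition nijenhuis ::
    "('v::real_vector \<Rightarrow> 'v \<Rightarrow> 'v) \<Rightarrow> ('v \<Rightarrow> 'v) \<Rightarrow> 'v \<Rightarrow> 'v \<Rightarrow> 'v" where
  "nijenhuis br J x y = br (J x) (J y) - J (br (J x) y) - J (br x (J y)) - br x y"

definition kaehler_form :: "('v \<Rightarrow> 'v \<Rightarrow> real) \<Rightarrow> ('v \<Rightarrow> 'v) \<Rightarrow> 'v \<Rightarrow> 'v \<Rightarrow> real" where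
  "kaehler_form g J x y = g x (J y)"

definition pseudo_kaehler ::
    "('v::real_vector \<Rightarrow> 'v \<Rightarrow> 'v) \<Rightarrow> ('v \<Rightarrow> 'v \<Rightarrow> real) \<Rightarrow> ('v \<Rightarrow> 'v) \<Rightarrow> ('v \<Rightarrow> 'v \<Rightarrow> real) \<Rightarrow> bool"
  where
  "pseudo_kaehler br g J \<omega> \<longleftrightarrow>
     lie_algebra br \<and> lie_metric g \<and> linear J \<and>
     (\<forall>x. J (J x) = - x) \<and>
     (\<forall>x y. nijenhuis br J x y = 0) \<and>
     (\<forall>x y. g (J x) (J y) = g x y) \<and>
     \<omega> = kaehler_form g J \<and>
     (\<forall>x y z. d2 br \<omega> x y z = 0)"


section \<open>The extensions\<close>

text \<open>
  The triple \<open>(x, s, t)\<close> stands for \<open>x + s b + t \<xi>\<close>, and \<open>(u, r)\<close> for \<open>u + r e\<^sub>0\<close>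
  with \<open>u\<close> in the central extension.
\<close>

fun ext_bracket ::
    "('v::real_vector \<Rightarrow> 'v \<Rightarrow> 'v) \<Rightarrow> ('v \<Rightarrow> 'v \<Rightarrow> real) \<Rightarrow> ('v \<Rightarrow> 'v) \<Rightarrow> real \<Rightarrow>
     'v \<times> real \<times> real \<Rightarrow> 'v \<times> real \<times> real \<Rightarrow> 'v \<times> real \<times> real" where
  "ext_bracket br \<omega> D \<tau> (x, s, t) (y, s', t') = (br x y, - \<tau> * act2 D \<omega> x y, - 2 * \<omega> x y)"

fun ext_metric ::
    "('v \<Rightarrow> 'v \<Rightarrow> real) \<Rightarrow> real \<Rightarrow> 'v \<times> real \<times> real \<Rightarrow> 'v \<times> real \<times> real \<Rightarrow> real" where
  "ext_metric g \<tau> (x, s, t) (y, s', t') = g x y + \<tau> * s * s' + t * t'"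

fun ext_deriv ::
    "('v \<Rightarrow> 'v) \<Rightarrow> real \<Rightarrow> real \<Rightarrow> 'v \<times> real \<times> real \<Rightarrow> 'v \<times> real \<times> real" where
  "ext_deriv D h \<tau> (x, s, t) = (D x, h * s, - 2 * \<tau> * s)"

fun semidirect_bracket ::
    "('w::real_vector \<Rightarrow> 'w \<Rightarrow> 'w) \<Rightarrow> ('w \<Rightarrow> 'w) \<Rightarrow> 'w \<times> real \<Rightarrow> 'w \<times> real \<Rightarrow> 'w \<times> real" where
  "semidirect_bracket br D (u, r) (v, r') = (br u v + r *\<^sub>R D v - r' *\<^sub>R D u, 0)"

fun semidirect_metric ::
    "('w \<Rightarrow> 'w \<Rightarrow> real) \<Rightarrow> real \<Rightarrow> 'w \<times> real \<Rightarrow> 'w \<times> real \<Rightarrow> real" where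
  "semidirect_metric g \<tau> (u, r) (v, r') = g u v + \<tau> * (r * r')"


section \<open>Well-definedness\<close>

lemma finite_dim_basis:
  assumes "finite_dim TYPE('v::real_vector)"
  obtains B :: "'v::real_vector set" where "finite B" "independent B" "span B = UNIV"
proof -
  obtain S :: "'v set" where S: "finite S" "span S = UNIV"
    using assms unfolding finite_dim_def by blast
  obtain B where B: "B \<subseteq> S" "independent B" "S \<subseteq> span B"
    using real_vector.maximal_independent_subset[of S] by metis
  have "span B = UNIV"
    using B S by (metis UNIV_eq_I span_mono span_span subset_antisym subset_UNIV)
  then show thesis
    using that B S finite_subset by blast
qed

lemma finite_dim_independent_finite:
  assumes "finite_dim TYPE('v::real_vector)" "independent (B::'v::real_vector set)"
  shows "finite B"
proof -
  obtain S :: "'v set" where S: "finite S" "span S = UNIV"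
    using assms unfolding finite_dim_def by blast
  show ?thesis
    using real_vector.independent_span_bound[OF S(1) assms(2)] S by auto
qed

lemma lin_trace_eq:
  fixes f :: "'v::real_vector \<Rightarrow> 'v"
  assumes fd: "finite_dim TYPE('v)" and f: "linear f"
    and B: "independent B" "span B = UNIV"
  shows "lin_trace f = (\<Sum>b\<in>B. representation B (f b) b)"
proof -
  have main: "(\<Sum>c\<in>C. representation C (f c) c) = (\<Sum>b\<in>B. representation B (f b) b)"
    if C: "independent C" "span C = UNIV" for C
  proof -
    have finB: "finite B" and finC: "finite C"
      using finite_dim_independent_finite[OF fd] B C by auto
    have linC: "linear (\<lambda>v. representation C v c)" for c
      using real_vector.linear_representation[OF C] C
      by (intro linearI) (simp_all add: real_vector.representation_add real_vector.representation_scale)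
    have linB: "linear (\<lambda>v. representation B v b)" for b
      by (intro linearI) (simp_all add: real_vector.representation_add real_vector.representation_scale B)
    have expB: "(\<Sum>b\<in>B. representation B v b *\<^sub>R b) = v" for v
      using real_vector.sum_representation_eq[OF B(1) _ finB order_refl] B by auto
    have expC: "(\<Sum>c\<in>C. representation C v c *\<^sub>R c) = v" for v
      using real_vector.sum_representation_eq[OF C(1) _ finC order_refl] C by auto
    have "(\<Sum>c\<in>C. representation C (f c) c)
        = (\<Sum>c\<in>C. \<Sum>b\<in>B. representation B c b * representation C (f b) c)"
    proof (rule sum.cong[OF refl])
      fix c assume "c \<in> C"
      have "representation C (f c) c = representation C (f (\<Sum>b\<in>B. representation B c b *\<^sub>R b)) c"
        by (simp add: expB)
      also have "\<dots> = (\<Sum>b\<in>B. representation B c b * representation C (f b) c)"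
        by (simp add: linear_sum[OF f] linear_cmul[OF f] linear_sum[OF linC] linear_cmul[OF linC])
      finally show "representation C (f c) c
          = (\<Sum>b\<in>B. representation B c b * representation C (f b) c)" .
    qed
    also have "\<dots> = (\<Sum>b\<in>B. \<Sum>c\<in>C. representation B c b * representation C (f b) c)"
      by (rule sum.swap)
    also have "\<dots> = (\<Sum>b\<in>B. representation B (f b) b)"
    proof (rule sum.cong[OF refl])
      fix b assume "b \<in> B"
      have "representation B (f b) b = representation B (\<Sum>c\<in>C. representation C (f b) c *\<^sub>R c) b"
        by (simp add: expC)
      also have "\<dots> = (\<Sum>c\<in>C. representation B c b * representation C (f b) c)"
        by (simp add: linear_sum[OF linB] linear_cmul[OF linB] mult.commute)
      finally show "(\<Sum>c\<in>C. representation B c b * representation C (f b) c)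
          = representation B (f b) b" by simp
    qed
    finally show ?thesis .
  qed
  have "\<exists>C::'v set. independent C \<and> span C = UNIV" using B by blast
  then have "independent (SOME C::'v set. independent C \<and> span C = UNIV)
      \<and> span (SOME C::'v set. independent C \<and> span C = UNIV) = UNIV"
    by (rule someI_ex)
  then show ?thesis
    unfolding lin_trace_def Let_def using main by blast
qed

lemma metric_represent:
  fixes g :: "'v::real_vector \<Rightarrow> 'v \<Rightarrow> real"
  assumes fd: "finite_dim TYPE('v)" and g: "lie_metric g" and p: "linear p"
  shows "\<exists>!v. \<forall>w. g v w = p w"
proof -
  obtain B :: "'v set" where B: "finite B" "independent B" "span B = UNIV"
    using finite_dim_basis[OF fd] .
  interpret fdv: finite_dimensional_vector_space "scaleR :: real \<Rightarrow> 'v \<Rightarrow> 'v" B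
    by unfold_locales
       (use B in \<open>auto simp: dependent_raw_def span_raw_def scaleR_add_right scaleR_add_left\<close>)
  have gl: "linear (\<lambda>v. g v w)" and gr: "linear (g v)" for v w
    using g unfolding lie_metric_def bilinear_def by (auto simp: eta_contract_eq)
  define T where "T v = (\<Sum>b\<in>B. g v b *\<^sub>R b)" for v
  have T: "linear T"
    unfolding T_def
    by (intro linearI)
       (simp_all add: linear_add[OF gl] linear_cmul[OF gl] scaleR_add_left sum.distrib scaleR_sum_right)
  have coeff: "(\<forall>b\<in>B. f b = f' b)" if "(\<Sum>b\<in>B. f b *\<^sub>R b) = (\<Sum>b\<in>B. f' b *\<^sub>R b)" for f f' :: "'v \<Rightarrow> real"
  proof -
    have "(\<Sum>b\<in>B. (f b - f' b) *\<^sub>R b) = 0"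
      using that by (simp add: scaleR_diff_left sum_subtractf)
    then have "f b - f' b = 0" if "b \<in> B" for b
      using real_vector.independentD[OF B(2,1) order_refl, of "\<lambda>b. f b - f' b"] that by blast
    then show ?thesis by simp
  qed
  have ext: "(\<forall>w. q w = q' w)" if "linear q" "linear q'" "\<forall>b\<in>B. q b = q' b" for q q' :: "'v \<Rightarrow> real"
    using linear_eq_on[OF that(1,2), of _ B] that(3) B(3) by auto
  have "inj T"
  proof (rule linear_injective_0[OF T, THEN iffD2], intro allI impI)
    fix v assume "T v = 0"
    then have "\<forall>b\<in>B. g v b = 0"
      using coeff[of "g v" "\<lambda>_. 0"] unfolding T_def by simp
    then have "\<forall>w. g v w = 0"
      using ext[OF gr, of "\<lambda>_. 0"] by (simp add: module_hom_zero)
    then show "v = 0" using g unfolding lie_metric_def by blast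
  qed
  then have "surj T"
    using fdv.linear_inj_imp_surj T unfolding linear_def by blast
  then obtain v where "T v = (\<Sum>b\<in>B. p b *\<^sub>R b)"
    by (metis surjD)
  then have "\<forall>b\<in>B. g v b = p b"
    using coeff unfolding T_def by blast
  then have v: "\<forall>w. g v w = p w" using ext[OF gr p] by blast
  show ?thesis
  proof (rule ex1I)
    show "\<forall>w. g v w = p w" by (fact v)
    fix v' assume "\<forall>w. g v' w = p w"
    then have "\<forall>w. g (v' - v) w = 0"
      using v by (simp add: linear_diff[OF gl])
    then have "v' - v = 0" using g unfolding lie_metric_def by blast
    then show "v' = v" by simp
  qed
qed

lemma metric_cancel:
  assumes "lie_metric g" "\<And>z. g x z = g y z"
  shows "x = y"
proof -
  have gl: "linear (\<lambda>v. g v w)" for w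
    using assms(1) unfolding lie_metric_def bilinear_def by blast
  have "\<forall>z. g (x - y) z = 0"
    by (simp add: linear_diff[OF gl] assms(2))
  then have "x - y = 0"
    using assms(1) unfolding lie_metric_def by blast
  then show ?thesis by simp
qed

lemma metric_adjoint:
  fixes g :: "'v::real_vector \<Rightarrow> 'v \<Rightarrow> real"
  assumes fd: "finite_dim TYPE('v)" and g: "lie_metric g" and f: "linear f"
  shows "g (metric_adjoint g f x) y = g x (f y)"
proof -
  have "linear (\<lambda>y. g x (f y))" for x
    using linear_compose[OF f, of "g x"] g unfolding lie_metric_def bilinear_def
    by (auto simp: o_def eta_contract_eq)
  then have "\<forall>x. \<exists>v. \<forall>y. g v y = g x (f y)"
    using metric_represent[OF fd g] by blast
  from choice[OF this] obtain f' where f': "\<forall>x y. g (f' x) y = g x (f y)"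
    by blast
  have "\<exists>!f'. \<forall>x y. g (f' x) y = g x (f y)"
  proof (rule ex1I)
    show "\<forall>x y. g (f' x) y = g x (f y)" by (fact f')
    fix k assume "\<forall>x y. g (k x) y = g x (f y)"
    then show "k = f'" using f' by (intro ext metric_cancel[OF g]) simp
  qed
  from theI'[OF this, folded metric_adjoint_def] show ?thesis by blast
qed

lemma lie_algebra_skew:
  assumes "lie_algebra br"
  shows "br x y = - br y x"
proof -
  have l: "linear (\<lambda>v. br v w)" and r: "linear (\<lambda>w. br v w)" for v w
    using assms unfolding lie_algebra_def bilinear_def by auto
  have "br (x + y) (x + y) = 0" "br x x = 0" "br y y = 0"
    using assms unfolding lie_algebra_def by auto
  then show ?thesis
    by (simp add: linear_add[OF l] linear_add[OF r] eq_neg_iff_add_eq_0 add.commute)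
qed

lemma levi_civita:
  fixes br :: "'v::real_vector \<Rightarrow> 'v \<Rightarrow> 'v"
  assumes L: "lie_algebra br" and g: "lie_metric g"
  shows levi_civita_bilinear: "bilinear (levi_civita br g)"
    and levi_civita_torsion: "levi_civita br g x y - levi_civita br g y x = br x y"
    and levi_civita_metric: "g (levi_civita br g x y) z + g y (levi_civita br g x z) = 0"
    and levi_civita_koszul:
      "2 * g (levi_civita br g x y) z = g (br x y) z - g (br y z) x + g (br z x) y"
proof -
  have fd: "finite_dim TYPE('v)" using L unfolding lie_algebra_def by blast
  have brl: "linear (\<lambda>v. br v w)" and brr: "linear (\<lambda>w. br v w)" for v w
    using L unfolding lie_algebra_def bilinear_def by auto
  have gl: "linear (\<lambda>v. g v w)" and gr: "linear (\<lambda>w. g v w)" for v w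
    using g unfolding lie_metric_def bilinear_def by auto
  have gs: "g x y = g y x" for x y using g unfolding lie_metric_def by blast
  note lins = linear_add[OF brl] linear_add[OF brr] linear_add[OF gl] linear_add[OF gr]
    linear_cmul[OF brl] linear_cmul[OF brr] linear_cmul[OF gl] linear_cmul[OF gr]
    linear_diff[OF gl] linear_diff[OF gr] linear_neg[OF gl] linear_neg[OF gr]
  have skew: "br x y = - br y x" for x y
    by (rule lie_algebra_skew[OF L])
  have gskew: "g (br x y) z = - g (br y x) z" for x y z
    by (subst skew) (rule linear_neg[OF gl])
  let ?K = "\<lambda>x y z. (g (br x y) z - g (br y z) x + g (br z x) y) / 2"
  have "linear (?K x y)" for x y
    by (intro linearI) (simp_all add: lins field_simps)
  then have "\<forall>x y. \<exists>v. \<forall>z. g v z = ?K x y z"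
    using metric_represent[OF fd g] by blast
  then obtain n where n: "\<And>x y z. g (n x y) z = ?K x y z" by metis
  have bil: "bilinear n"
    unfolding bilinear_def
    by (intro conjI allI linearI; rule metric_cancel[OF g]) (simp_all add: n lins field_simps)
  have tors: "n x y - n y x = br x y" for x y
  proof (rule metric_cancel[OF g])
    fix z
    show "g (n x y - n y x) z = g (br x y) z"
      using gskew[of y x z] gskew[of x z y] gskew[of y z x]
      by (simp add: n linear_diff[OF gl] field_simps)
  qed
  have met: "g (n x y) z + g y (n x z) = 0" for x y z
    using gskew[of z y x] gskew[of y x z] gskew[of z x y] n[of x y z] n[of x z y] gs[of y "n x z"]
    by (simp add: field_simps)
  have koszul: "2 * g (m x y) z = g (br x y) z - g (br y z) x + g (br z x) y"
    if m: "\<forall>x y. m x y - m y x = br x y" "\<forall>x y z. g (m x y) z + g y (m x z) = 0" for m x y z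
  proof -
    have t: "g (br x y) z = g (m x y) z - g (m y x) z" for x y z
      by (simp add: m(1)[rule_format, symmetric] linear_diff[OF gl])
    have s: "g (m x y) z = - g (m x z) y" for x y z
      using m(2)[rule_format, of x y z] gs[of y "m x z"] by simp
    show ?thesis
      using s[of x z y] s[of y z x] s[of z y x] t[of x y z] t[of y z x] t[of z x y] by linarith
  qed
  have ex1: "\<exists>!n. bilinear n \<and> (\<forall>x y. n x y - n y x = br x y) \<and>
        (\<forall>x y z. g (n x y) z + g y (n x z) = 0)"
  proof (rule ex1I[of _ n])
    show "bilinear n \<and> (\<forall>x y. n x y - n y x = br x y) \<and> (\<forall>x y z. g (n x y) z + g y (n x z) = 0)"
      using bil tors met by blast
    fix m assume m: "bilinear m \<and> (\<forall>x y. m x y - m y x = br x y) \<and> (\<forall>x y z. g (m x y) z + g y (m x z) = 0)"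
    show "m = n"
    proof (intro ext metric_cancel[OF g])
      fix x y z
      show "g (m x y) z = g (n x y) z"
        using koszul[of m x y z] m n[of x y z] by simp
    qed
  qed
  note lc = theI'[OF ex1, folded levi_civita_def]
  show "bilinear (levi_civita br g)" using lc by blast
  show "levi_civita br g x y - levi_civita br g y x = br x y" using lc by blast
  show "g (levi_civita br g x y) z + g y (levi_civita br g x z) = 0" using lc by blast
  show "2 * g (levi_civita br g x y) z = g (br x y) z - g (br y z) x + g (br z x) y"
    using koszul lc by blast
qed

text \<open>The structure equations of the central extension, with \<open>b = (0, 1, 0)\<close> and \<open>\<xi> = (0, 0, 1)\<close>.\<close>

lemma ext_structure_equations:
  assumes "bilinear g" "\<tau> = 1 \<or> \<tau> = -1"
  shows "d1 (ext_bracket br \<omega> D \<tau>) (flat (ext_metric g \<tau>) (0, 0, 1)) u v = 2 * \<omega> (fst u) (fst v)"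
    and "d1 (ext_bracket br \<omega> D \<tau>) (flat (ext_metric g \<tau>) (0, 1, 0)) u v = act2 D \<omega> (fst u) (fst v)"
proof -
  have "g 0 x = 0" for x
    using bilinear_lzero[OF assms(1)] .
  then show "d1 (ext_bracket br \<omega> D \<tau>) (flat (ext_metric g \<tau>) (0, 0, 1)) u v = 2 * \<omega> (fst u) (fst v)"
    and "d1 (ext_bracket br \<omega> D \<tau>) (flat (ext_metric g \<tau>) (0, 1, 0)) u v = act2 D \<omega> (fst u) (fst v)"
    using assms(2) by (cases u; cases v; auto simp: d1_def flat_def)+
qed

lemma finite_dim_prod:
  assumes "finite_dim TYPE('a::real_vector)" "finite_dim TYPE('b::real_vector)"
  shows "finite_dim TYPE('a \<times> 'b)"
proof -
  obtain A :: "'a set" and B :: "'b set"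
    where A: "finite A" "span A = UNIV" and B: "finite B" "span B = UNIV"
    using assms unfolding finite_dim_def by blast
  have l: "linear (\<lambda>x::'a. (x, 0::'b))" and r: "linear (\<lambda>y::'b. (0::'a, y))"
    by (auto intro!: linearI)
  let ?C = "(\<lambda>x. (x, 0)) ` A \<union> (\<lambda>y. (0, y)) ` B"
  have "(x, y) \<in> span ?C" for x y
  proof -
    have "(x, 0) \<in> span ?C"
      using linear_span_image[OF l, of A] A(2) span_mono[of "(\<lambda>x. (x, 0)) ` A" ?C] by blast
    moreover have "(0, y) \<in> span ?C"
      using linear_span_image[OF r, of B] B(2) span_mono[of "(\<lambda>y. (0, y)) ` B" ?C] by blast
    ultimately show ?thesis
      using span_add[of "(x, 0)" ?C "(0, y)"] by simp
  qed
  then have "span ?C = UNIV" by auto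
  then show ?thesis
    unfolding finite_dim_def using A(1) B(1) by (intro exI[of _ ?C]) simp
qed

lemma finite_dim_real: "finite_dim TYPE(real)"
  unfolding finite_dim_def 
proof (intro exI conjI)
  show "span (Basis :: real set) = UNIV" by (rule span_Basis)
qed (rule finite_Basis)

lemma metric_tilde:
  assumes g: "lie_metric g" and \<tau>: "\<tau> = 1 \<or> \<tau> = -1"
  shows "lie_metric (semidirect_metric (ext_metric g \<tau>) \<tau>)"
proof -
  have gl: "linear (\<lambda>v. g v w)" and gr: "linear (\<lambda>w. g v w)" for v w
    using g unfolding lie_metric_def bilinear_def by auto
  have gs: "g x y = g y x" for x y using g unfolding lie_metric_def by blast
  let ?m = "semidirect_metric (ext_metric g \<tau>) \<tau>"
  have "bilinear ?m"
    unfolding bilinear_def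
    by (intro conjI allI linearI)
       (auto simp: linear_add[OF gl] linear_add[OF gr] linear_cmul[OF gl] linear_cmul[OF gr]
          algebra_simps split: prod.splits elim!: semidirect_metric.elims)
  moreover have "?m u v = ?m v u" for u v
    by (cases u; cases v) (auto simp: gs)
  moreover have "u = 0" if u: "\<And>v. ?m u v = 0" for u
  proof -
    obtain x s t r where [simp]: "u = ((x, s, t), r)" by (metis prod.exhaust)
    have g0: "g z 0 = 0" for z using linear_0[OF gr] .
    have "g x y = 0" for y using u[of "((y, 0, 0), 0)"] by simp
    then have "x = 0" using g unfolding lie_metric_def by blast
    moreover have "s = 0" "t = 0" "r = 0"
      using u[of "((0, 1, 0), 0)"] u[of "((0, 0, 1), 0)"] u[of "((0, 0, 0), 1)"] \<tau>
      by (auto simp: g0)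
    ultimately show ?thesis by (simp add: zero_prod_def)
  qed
  ultimately show ?thesis unfolding lie_metric_def by blast
qed

lemma lie_algebra_semidirect:
  fixes br :: "'w::real_vector \<Rightarrow> 'w \<Rightarrow> 'w"
  assumes L: "lie_algebra br" and D: "derivation br D"
  shows "lie_algebra (semidirect_bracket br D)"
proof -
  have brl: "linear (\<lambda>v. br v w)" and brr: "linear (\<lambda>w. br v w)" for v w
    using L unfolding lie_algebra_def bilinear_def by auto
  have lD: "linear D" and dD: "D (br x y) = br (D x) y + br x (D y)" for x y
    using D unfolding derivation_def by auto
  have alt: "br x x = 0" and jac: "br x (br y z) + br y (br z x) + br z (br x y) = 0" for x y z
    using L unfolding lie_algebra_def by auto
  note lins = linear_add[OF brl] linear_add[OF brr] linear_diff[OF brl] linear_diff[OF brr]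
    linear_cmul[OF brl] linear_cmul[OF brr] linear_add[OF lD] linear_diff[OF lD] linear_cmul[OF lD]
  have skew: "br x y = - br y x" for x y
    by (rule lie_algebra_skew[OF L])
  let ?B = "semidirect_bracket br D"
  have "finite_dim TYPE('w \<times> real)"
    using L finite_dim_prod finite_dim_real unfolding lie_algebra_def by blast
  moreover have "bilinear ?B"
    unfolding bilinear_def
    by (intro conjI allI linearI) (auto simp: lins algebra_simps elim!: semidirect_bracket.elims)
  moreover have "?B u u = 0" for u
    by (cases u) (simp add: alt zero_prod_def)
  moreover have "?B u (?B v w) + ?B v (?B w u) + ?B w (?B u v) = 0" for u v w
  proof -
    obtain x r y s z t where [simp]: "u = (x, r)" "v = (y, s)" "w = (z, t)" by (metis prod.exhaust)
    have j: "br x (br y z) = - br y (br z x) - br z (br x y)"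
      using jac[of x y z] by (simp add: algebra_simps eq_neg_iff_add_eq_0)
    show ?thesis
      by (simp add: lins dD j skew[of "D x"] skew[of "D y"] skew[of "D z"] algebra_simps zero_prod_def)
  qed
  ultimately show ?thesis unfolding lie_algebra_def by blast
qed

lemma
  fixes br :: "'v::real_vector \<Rightarrow> 'v \<Rightarrow> 'v"
  assumes K: "pseudo_kaehler br g J \<omega>" and D: "derivation br D"
    and \<tau>: "\<tau> = 1 \<or> \<tau> = -1"
    and JD: "J \<circ> D = D \<circ> J"
    and comm: "\<And>x. sym_part g D (skew_part g D x) - skew_part g D (sym_part g D x)
              = h *\<^sub>R sym_part g D x - 2 *\<^sub>R sym_part g D (sym_part g D x)"
  shows lie_algebra_ext: "lie_algebra (ext_bracket br \<omega> D \<tau>)"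
    and derivation_ext: "derivation (ext_bracket br \<omega> D \<tau>) (ext_deriv D h \<tau>)"
proof -
  have L: "lie_algebra br" and g: "lie_metric g" and J: "linear J" "\<And>x. J (J x) = - x"
    and inv: "\<And>x y. g (J x) (J y) = g x y" and \<omega>_eq: "\<omega> = kaehler_form g J"
    and closed: "\<And>x y z. d2 br \<omega> x y z = 0"
    using K unfolding pseudo_kaehler_def by blast+
  have \<omega>: "\<omega> x y = g x (J y)" for x y
    by (simp add: \<omega>_eq kaehler_form_def)
  have fd: "finite_dim TYPE('v)" using L unfolding lie_algebra_def by blast
  have brl: "linear (\<lambda>v. br v w)" and brr: "linear (\<lambda>w. br v w)" for v w
    using L unfolding lie_algebra_def bilinear_def by auto
  have gl: "linear (\<lambda>v. g v w)" and gr: "linear (\<lambda>w. g v w)" for v w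
    using g unfolding lie_metric_def bilinear_def by auto
  have gs: "g x y = g y x" for x y using g unfolding lie_metric_def by blast
  have lD: "linear D" and dD: "D (br x y) = br (D x) y + br x (D y)" for x y
    using D unfolding derivation_def by auto
  have alt: "br x x = 0" and jac: "br x (br y z) + br y (br z x) + br z (br x y) = 0" for x y z
    using L unfolding lie_algebra_def by auto
  note lins = linear_add[OF brl] linear_add[OF brr] linear_diff[OF brl] linear_diff[OF brr]
    linear_cmul[OF brl] linear_cmul[OF brr] linear_add[OF lD] linear_diff[OF lD] linear_cmul[OF lD]
    linear_add[OF gl] linear_add[OF gr] linear_cmul[OF gl] linear_cmul[OF gr]
    linear_add[OF J(1)] linear_cmul[OF J(1)]
  have wskew: "\<omega> x y = - \<omega> y x" for x y
    using inv[of x "J y"] gs[of "J x" y] by (simp add: \<omega> J(2) linear_neg[OF gr])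
  have wl: "linear (\<lambda>v. \<omega> v w)" and wr: "linear (\<lambda>w. \<omega> v w)" for v w
    by (auto intro!: linearI simp: \<omega> lins)
  have cyc: "\<omega> x (br y z) + \<omega> y (br z x) + \<omega> z (br x y) = 0" for x y z
  proof -
    have "br x z = - br z x"
      by (rule lie_algebra_skew[OF L])
    then have "\<omega> (br x z) y = - \<omega> (br z x) y" by (simp add: linear_neg[OF wl])
    then show ?thesis
      using closed[of x y z] wskew[of "br x y" z] wskew[of "br z x" y] wskew[of "br y z" x]
      unfolding d2_def by linarith
  qed
  note lins = lins linear_add[OF wl] linear_add[OF wr] linear_cmul[OF wl] linear_cmul[OF wr]
  let ?a = "act2 D \<omega>"
  let ?S = "sym_part g D" and ?A = "skew_part g D" and ?D' = "metric_adjoint g D"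
  have a_alt: "?a x x = 0" and w_alt: "\<omega> x x = 0" for x
    using wskew[of "D x" x] wskew[of x x] by (auto simp: act2_def)
  have a_cyc: "?a x (br y z) + ?a y (br z x) + ?a z (br x y) = 0" for x y z
    using cyc[of "D x" y z] cyc[of x "D y" z] cyc[of x y "D z"]
    by (simp add: act2_def dD lins)
  have lB: "bilinear (ext_bracket br \<omega> D \<tau>)"
    unfolding bilinear_def
    by (intro conjI allI linearI) (auto simp: act2_def lins algebra_simps elim!: ext_bracket.elims)
  show "lie_algebra (ext_bracket br \<omega> D \<tau>)"
    unfolding lie_algebra_def
  proof (intro conjI allI lB)
    show "finite_dim TYPE('v \<times> real \<times> real)"
      by (intro finite_dim_prod finite_dim_real fd)
    fix u v w :: "'v \<times> real \<times> real"
    show "ext_bracket br \<omega> D \<tau> u u = 0"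
      by (cases u) (simp add: alt a_alt w_alt zero_prod_def)
    obtain x s t y s' t' z s'' t'' where [simp]:
      "u = (x, s, t)" "v = (y, s', t')" "w = (z, s'', t'')" by (metis prod.exhaust)
    have "- (\<tau> * ?a x (br y z)) - \<tau> * ?a y (br z x) - \<tau> * ?a z (br x y)
        = - \<tau> * (?a x (br y z) + ?a y (br z x) + ?a z (br x y))"
      by (simp add: algebra_simps)
    then show "ext_bracket br \<omega> D \<tau> u (ext_bracket br \<omega> D \<tau> v w) +
        ext_bracket br \<omega> D \<tau> v (ext_bracket br \<omega> D \<tau> w u) +
        ext_bracket br \<omega> D \<tau> w (ext_bracket br \<omega> D \<tau> u v) = 0"
      using jac[of x y z] cyc[of x y z] by (simp add: a_cyc zero_prod_def)
  qed
  have adj: "g (?D' x) y = g x (D y)" for x y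
    by (rule metric_adjoint[OF fd g lD])
  have JD': "J (D y) = D (J y)" for y
    using JD by (metis comp_apply)
  have DS: "D x = ?S x + ?A x" and D'S: "?D' x = ?S x - ?A x" for x
    by (simp_all add: sym_part_def skew_part_def flip: scaleR_add_right scaleR_diff_right)
  have aS: "?a x y = - 2 * g (?S x) (J y)" for x y
    by (simp add: act2_def \<omega> sym_part_def JD' lins adj)
  have lS: "linear ?S"
  proof (rule linearI; rule metric_cancel[OF g])
    show "g (?S (x + y)) z = g (?S x + ?S y) z" for x y z
      by (simp add: sym_part_def lins adj field_simps)
    show "g (?S (c *\<^sub>R x)) z = g (c *\<^sub>R ?S x) z" for c x z
      by (simp add: sym_part_def lins adj field_simps)
  qed
  have key: "?S (D x) + ?D' (?S x) = h *\<^sub>R ?S x" for x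
    using comm[of x] by (simp add: DS[of x] D'S[of "?S x"] linear_add[OF lS] scaleR_2 algebra_simps)
  have aD: "?a (D x) y + ?a x (D y) = h * ?a x y" for x y
  proof -
    have "?a (D x) y + ?a x (D y) = - 2 * g (?S (D x) + ?D' (?S x)) (J y)"
      by (simp add: aS JD' adj lins)
    then show ?thesis by (simp add: key lins aS)
  qed
  show "derivation (ext_bracket br \<omega> D \<tau>) (ext_deriv D h \<tau>)"
    unfolding derivation_def
  proof (intro conjI allI)
    show "linear (ext_deriv D h \<tau>)"
      by (intro linearI) (auto simp: lins algebra_simps)
    fix u v :: "'v \<times> real \<times> real"
    obtain x s t y s' t' where [simp]: "u = (x, s, t)" "v = (y, s', t')" by (metis prod.exhaust)
    have "h * (- (\<tau> * ?a x y)) = - \<tau> * (?a (D x) y + ?a x (D y))"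
      by (simp add: aD)
    moreover have "2 * \<tau> * (\<tau> * ?a x y) = - 2 * \<omega> (D x) y - 2 * \<omega> x (D y)"
      using \<tau> by (auto simp: act2_def)
    ultimately show "ext_deriv D h \<tau> (ext_bracket br \<omega> D \<tau> u v) =
        ext_bracket br \<omega> D \<tau> (ext_deriv D h \<tau> u) v + ext_bracket br \<omega> D \<tau> u (ext_deriv D h \<tau> v)"
      by (simp add: dD algebra_simps)
  qed
qed

end

theory Submission
  imports Defs
begin

text \<open>
  Write \<open>N\<^sub>v\<close> for the endomorphism \<open>u \<mapsto> \<nabla>\<^sub>u v\<close>.  For any metric on a Lie algebra the Ricci tensor is
  \<open>ric(y, z) = - tr (N\<^sub>z N\<^sub>y) - tr ad(\<nabla>\<^sub>y z)\<close> (\<open>ricci_eq\<close>), so that no curvature of the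
  extension has to be computed: its Levi-Civita connection (\<open>ext_nabla\<close>) is enough.

  The base contributes nothing, because a nilpotent pseudo-Kaehler Lie algebra is Ricci-flat
  (\<open>ricci_flat_nilpotent\<close>).  As \<open>J\<close> is parallel, \<open>ric(y, J z)\<close> is \<open>-1/2\<close> times the trace of
  \<open>J R(y, z)\<close>.  The commutator part of \<open>R(y, z)\<close> drops out of this trace and leaves
  \<open>tr (J \<nabla>\<^sub>w)\<close> with \<open>w = [y, z]\<close>, which equals \<open>tr (J ad w) - tr ad (J w)\<close>.  Both
  traces vanish by nilpotency.  This is clear for the second; for the first, integrability makes
  \<open>ad x + J ad (J x)\<close> the action of the anti-holomorphic vector \<open>x + i J x\<close> on
  the quotient of the complexified algebra by its \<open>(0, 1)\<close> part, hence a nilpotent operator.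

  Let \<open>S\<close> be the symmetric part of \<open>D\<close>, and \<open>n\<close> the dimension of the base.  Traces over the
  extension split into a trace over the base and three scalars, and the terms quadratic in \<open>S\<close> on
  the base cancel because of the commutator hypothesis (\<open>ext_ricci\<close>).  There remains
  \<open>ric(\<xi>, \<xi>) = n + 2\<close>, which fixes the Einstein constant, and
  \<open>ric(x, y) = - 2 g(x, y) - \<tau> (tr S + 2 h) g(S x, y)\<close> on the base.
  Thus an Einstein metric forces \<open>S = s Id\<close> with \<open>s \<noteq> 0\<close>.  The commutator hypothesis then gives
  \<open>h = 2 s\<close>, and the equation becomes \<open>- \<tau> s\<^sup>2 (n + 4) = n + 4\<close>, that is, \<open>\<tau> = -1\<close> and \<open>s = \<plusminus>1\<close>.
  If the base is zero, the equation on the base is void; \<open>ric(e\<^sub>0, e\<^sub>0) = - h\<^sup>2 - 2 \<tau>\<close> replaces it.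
  Conversely, for \<open>S = \<plusminus>Id\<close> all remaining traces over the base are those of
  \<open>J\<close>, of \<open>N\<^sub>x\<close>, of \<open>J N\<^sub>x\<close> and of \<open>N\<^sub>x N\<^sub>y\<close>, which vanish, and of the identity.
\<close>

section \<open>Traces of endomorphisms\<close>

lemma linear_representation_coeff:
  assumes "independent (B::'v::real_vector set)" "span B = UNIV"
  shows "linear (\<lambda>x. representation B x b)"
  using assms by (intro linearI) (simp_all add: representation_add representation_scale)

lemma sum_representation_UNIV:
  assumes "finite_dim TYPE('v)" "independent (B::'v::real_vector set)" "span B = UNIV"
  shows "(\<Sum>b\<in>B. representation B v b *\<^sub>R b) = v"
  using real_vector.sum_representation_eq[OF assms(2) _ finite_dim_independent_finite[OF assms(1,2)] order_refl]
    assms(3) by auto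

lemma lin_trace_add:
  assumes "finite_dim TYPE('v)" "linear f" "linear (f'::'v::real_vector \<Rightarrow> 'v)"
  shows "lin_trace (\<lambda>x. f x + f' x) = lin_trace f + lin_trace f'"
proof -
  obtain B :: "'v set" where B: "finite B" "independent B" "span B = UNIV"
    using finite_dim_basis[OF assms(1)] .
  show ?thesis
    using B by (simp add: lin_trace_eq[OF assms(1) _ B(2,3)] linear_compose_add assms
        representation_add sum.distrib)
qed

lemma lin_trace_scaleR:
  assumes "finite_dim TYPE('v)" "linear (f::'v::real_vector \<Rightarrow> 'v)"
  shows "lin_trace (\<lambda>x. c *\<^sub>R f x) = c * lin_trace f"
proof -
  obtain B :: "'v set" where B: "finite B" "independent B" "span B = UNIV"
    using finite_dim_basis[OF assms(1)] .
  show ?thesis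
    using B by (simp add: lin_trace_eq[OF assms(1) _ B(2,3)] linear_compose_scale_right assms
        representation_scale sum_distrib_left)
qed

lemma lin_trace_uminus:
  assumes "finite_dim TYPE('v)" "linear (f::'v::real_vector \<Rightarrow> 'v)"
  shows "lin_trace (\<lambda>x. - f x) = - lin_trace f"
  using lin_trace_scaleR[OF assms, of "-1"] by simp

lemma lin_trace_diff:
  assumes "finite_dim TYPE('v)" "linear f" "linear (f'::'v::real_vector \<Rightarrow> 'v)"
  shows "lin_trace (\<lambda>x. f x - f' x) = lin_trace f - lin_trace f'"
  using lin_trace_add[OF assms(1,2) linear_compose_neg[OF assms(3)]]
  by (simp add: lin_trace_uminus[OF assms(1,3)])

lemma lin_trace_rank_one:
  assumes "finite_dim TYPE('v)" and p: "linear p"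
  shows "lin_trace (\<lambda>x::'v::real_vector. p x *\<^sub>R v) = p v"
proof -
  obtain B :: "'v set" where B: "finite B" "independent B" "span B = UNIV"
    using finite_dim_basis[OF assms(1)] .
  have l: "linear (\<lambda>x. p x *\<^sub>R v)"
    by (intro linearI) (simp_all add: linear_add[OF p] linear_cmul[OF p] scaleR_add_left)
  have "lin_trace (\<lambda>x. p x *\<^sub>R v) = (\<Sum>b\<in>B. representation B v b * p b)"
    using B by (simp add: lin_trace_eq[OF assms(1) l B(2,3)] representation_scale mult.commute)
  also have "\<dots> = p (\<Sum>b\<in>B. representation B v b *\<^sub>R b)"
    by (simp add: linear_sum[OF p] linear_cmul[OF p])
  finally show ?thesis
    by (simp add: sum_representation_UNIV[OF assms(1) B(2,3)])
qed

text \<open>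
  Every endomorphism is a sum \<open>\<Sum>b\<in>B. representation B x b *\<^sub>R f b\<close> of rank-one maps, so this
  formula yields the behaviour of the trace under commutation and adjoints.
\<close>

lemma lin_trace_finite_rank:
  fixes v :: "'i \<Rightarrow> 'v::real_vector"
  assumes fd: "finite_dim TYPE('v)" and "finite I" and p: "\<And>i. linear (p i)"
  shows "lin_trace (\<lambda>x. \<Sum>i\<in>I. p i x *\<^sub>R v i) = (\<Sum>i\<in>I. p i (v i))"
  using \<open>finite I\<close>
proof induction
  case empty
  have "linear (\<lambda>x::'v. 0::real)" by (intro linearI) auto
  from lin_trace_rank_one[OF fd this, of 0] show ?case by simp
next
  case (insert i I)
  have l: "linear (\<lambda>x. p i x *\<^sub>R v i)" for i
    by (intro linearI) (simp_all add: linear_add[OF p] linear_cmul[OF p] scaleR_add_left)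
  show ?case
    using insert by (simp add: lin_trace_add[OF fd l linear_compose_sum] l lin_trace_rank_one[OF fd p])
qed

lemma lin_trace_commute:
  fixes f :: "'v::real_vector \<Rightarrow> 'w::real_vector"
  assumes fdv: "finite_dim TYPE('v)" and fdw: "finite_dim TYPE('w)"
    and f: "linear f" and f': "linear f'"
  shows "lin_trace (\<lambda>y. f (f' y)) = lin_trace (\<lambda>x. f' (f x))"
proof -
  obtain B :: "'v set" where B: "finite B" "independent B" "span B = UNIV"
    using finite_dim_basis[OF fdv] .
  let ?r = "\<lambda>b x. representation B x b"
  have r: "linear (\<lambda>y. ?r b (f' y))" for b
    using linear_compose[OF f' linear_representation_coeff[OF B(2,3)]] by (simp add: o_def)
  have ex: "f x = (\<Sum>b\<in>B. ?r b x *\<^sub>R f b)" for x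
    by (subst sum_representation_UNIV[OF fdv B(2,3), of x, symmetric])
       (simp add: linear_sum[OF f] linear_cmul[OF f])
  have "lin_trace (\<lambda>y. f (f' y)) = lin_trace (\<lambda>y. \<Sum>b\<in>B. ?r b (f' y) *\<^sub>R f b)"
    by (subst ex) simp
  also have "\<dots> = (\<Sum>b\<in>B. ?r b (f' (f b)))"
    by (rule lin_trace_finite_rank[OF fdw B(1) r])
  also have "\<dots> = lin_trace (\<lambda>x. f' (f x))"
    using lin_trace_eq[OF fdv linear_compose[OF f f'] B(2,3)] by (simp add: o_def)
  finally show ?thesis .
qed

lemma lin_trace_prod:
  fixes f :: "'v::real_vector \<times> 'w::real_vector \<Rightarrow> 'v \<times> 'w"
  assumes fdv: "finite_dim TYPE('v)" and fdw: "finite_dim TYPE('w)" and f: "linear f"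
  shows "lin_trace f = lin_trace (\<lambda>x. fst (f (x, 0))) + lin_trace (\<lambda>y. snd (f (0, y)))"
proof -
  have i: "linear (\<lambda>x::'v. (x, 0::'w))" "linear (\<lambda>y::'w. (0::'v, y))"
    by (auto intro!: linearI)
  have p: "linear (\<lambda>z. fst (f z))" "linear (\<lambda>z. snd (f z))"
    by (intro linearI; simp add: linear_add[OF f] linear_cmul[OF f])+
  note fdp = finite_dim_prod[OF fdv fdw]
  have eq: "f = (\<lambda>z. (fst (f z), 0) + (0, snd (f z)))"
    by (simp add: fun_eq_iff)
  have "lin_trace f = lin_trace (\<lambda>z. (fst (f z), 0::'w)) + lin_trace (\<lambda>z. (0::'v, snd (f z)))"
    by (subst eq, rule lin_trace_add[OF fdp])
       (use linear_compose[OF p(1) i(1)] linear_compose[OF p(2) i(2)] in \<open>simp_all add: o_def\<close>)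
  also have "lin_trace (\<lambda>z. (fst (f z), 0::'w)) = lin_trace (\<lambda>x. fst (f (x, 0)))"
    by (rule lin_trace_commute[OF fdv fdp i(1) p(1)])
  also have "lin_trace (\<lambda>z. (0::'v, snd (f z))) = lin_trace (\<lambda>y. snd (f (0, y)))"
    by (rule lin_trace_commute[OF fdw fdp i(2) p(2)])
  finally show ?thesis .
qed

lemma lin_trace_real:
  assumes "linear (f :: real \<Rightarrow> real)"
  shows "lin_trace f = f 1"
proof -
  have "linear (\<lambda>x::real. x)" by (intro linearI) auto
  moreover have "f = (\<lambda>x. x *\<^sub>R f 1)"
  proof
    fix x show "f x = x *\<^sub>R f 1" using linear_cmul[OF assms, of x 1] by simp
  qed
  ultimately show ?thesis
    using lin_trace_rank_one[OF finite_dim_real, of "\<lambda>x. x" "f 1"] by metis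
qed

lemma lin_trace_ident_nonneg:
  assumes "finite_dim TYPE('v)"
  shows "lin_trace (\<lambda>x::'v::real_vector. x) \<ge> 0"
proof -
  obtain B :: "'v set" where B: "finite B" "independent B" "span B = UNIV"
    using finite_dim_basis[OF assms(1)] .
  have "linear (\<lambda>x::'v. x)" by (intro linearI) auto
  from lin_trace_eq[OF assms this B(2,3)] show ?thesis
    using B by (simp add: representation_basis)
qed

text \<open>
  If \<open>d b\<close> represents the coordinate \<open>b\<close> by means of the metric, then \<open>f' x = \<Sum>b\<in>B. g x (f b) *\<^sub>R d b\<close>,
  and both traces are \<open>\<Sum>b\<in>B. g (d b) (f b)\<close>.
\<close>

lemma lin_trace_adjoint:
  fixes g :: "'v::real_vector \<Rightarrow> 'v \<Rightarrow> real"
  assumes fd: "finite_dim TYPE('v)" and g: "lie_metric g" and f: "linear f"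
    and adj: "\<And>x y. g (f' x) y = g x (f y)"
  shows "lin_trace f' = lin_trace f"
proof -
  obtain B :: "'v set" where B: "finite B" "independent B" "span B = UNIV"
    using finite_dim_basis[OF fd] .
  have gl: "linear (\<lambda>v. g v w)" and gr: "linear (g v)" for v w
    using g unfolding lie_metric_def bilinear_def by (auto simp: eta_contract_eq)
  have "\<exists>d. \<forall>x. g d x = representation B x b" for b
    using metric_represent[OF fd g linear_representation_coeff[OF B(2,3)]] by blast
  then obtain d where d: "\<And>b x. g (d b) x = representation B x b" by metis
  have "f' x = (\<Sum>b\<in>B. g x (f b) *\<^sub>R d b)" for x
  proof (rule metric_cancel[OF g])
    fix z
    have "g (f' x) z = g x (f (\<Sum>b\<in>B. representation B z b *\<^sub>R b))"
      by (simp add: adj sum_representation_UNIV[OF fd B(2,3)])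
    also have "\<dots> = g (\<Sum>b\<in>B. g x (f b) *\<^sub>R d b) z"
      by (simp add: linear_sum[OF f] linear_cmul[OF f] linear_sum[OF gr] linear_cmul[OF gr]
          linear_sum[OF gl] linear_cmul[OF gl] d mult.commute)
    finally show "g (f' x) z = g (\<Sum>b\<in>B. g x (f b) *\<^sub>R d b) z" .
  qed
  then have "f' = (\<lambda>x. \<Sum>b\<in>B. g x (f b) *\<^sub>R d b)" by blast
  then have "lin_trace f' = (\<Sum>b\<in>B. g (d b) (f b))"
    using lin_trace_finite_rank[OF fd B(1) gl, of "\<lambda>b. f b" d] by simp
  then show ?thesis
    by (simp add: d lin_trace_eq[OF fd f B(2,3)])
qed

lemma lin_trace_skew:
  fixes g :: "'v::real_vector \<Rightarrow> 'v \<Rightarrow> real"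
  assumes fd: "finite_dim TYPE('v)" and g: "lie_metric g" and f: "linear f"
    and skew: "\<And>x y. g (f x) y + g x (f y) = 0"
  shows "lin_trace f = 0"
proof -
  have gl: "linear (\<lambda>v. g v w)" for w
    using g unfolding lie_metric_def bilinear_def by blast
  have "g (- f x) y = g x (f y)" for x y
    using skew[of x y] by (simp add: linear_neg[OF gl])
  from lin_trace_adjoint[OF fd g f this] show ?thesis
    by (simp add: lin_trace_uminus[OF fd f])
qed

text \<open>
  A basis adapted to the filtration by the kernels of the powers of \<open>f\<close> makes \<open>f\<close> strictly
  triangular.
\<close>

lemma lin_trace_nilpotent:
  fixes f :: "'v::real_vector \<Rightarrow> 'v"
  assumes fd: "finite_dim TYPE('v)" and f: "linear f" and nil: "\<And>x. (f ^^ n) x = 0"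
  shows "lin_trace f = 0"
proof -
  let ?K = "\<lambda>k. {x. (f ^^ k) x = 0}"
  have lk: "linear (f ^^ k)" for k
  proof (induction k)
    case 0
    show ?case by (simp only: funpow.simps linear_id)
  next
    case (Suc k)
    show ?case unfolding funpow.simps by (rule linear_compose[OF Suc f])
  qed
  have sub: "subspace (?K k)" for k
    by (rule subspaceI) (auto simp: linear_add[OF lk] linear_cmul[OF lk] linear_0[OF lk])
  have "\<exists>B. independent B \<and> span B = ?K k \<and> (\<forall>b\<in>B. representation B (f b) b = 0)" for k
  proof (induction k)
    case 0
    show ?case by (intro exI[of _ "{}"]) (auto simp: independent_empty)
  next
    case (Suc k)
    then obtain B where B: "independent B" "span B = ?K k" "\<And>b. b \<in> B \<Longrightarrow> representation B (f b) b = 0"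
      by blast
    have fB: "f x \<in> span B" if "x \<in> ?K (Suc k)" for x
      using that unfolding B(2) by (simp add: funpow_swap1)
    have "?K k \<subseteq> ?K (Suc k)"
      by (auto simp: linear_0[OF f])
    then have "B \<subseteq> ?K (Suc k)"
      using B(2) span_superset[of B] by blast
    then obtain C where C: "B \<subseteq> C" "C \<subseteq> ?K (Suc k)" "independent C" "?K (Suc k) \<subseteq> span C"
      using maximal_independent_subset_extend[of B "?K (Suc k)"] B(1) by metis
    \<comment> \<open>For \<open>c \<in> C - B\<close> the vector \<open>f c\<close> lies in \<open>span B\<close>, so it has no \<open>c\<close>-coordinate.\<close>
    have "representation C (f c) c = 0" if "c \<in> C" for c
    proof -
      have fc: "f c \<in> span B" using fB C(2) that by blast
      have "representation C (f c) = representation B (f c)"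
        by (rule representation_extend[OF C(3) fc C(1)])
      moreover have "representation B (f c) c = 0"
        using B(3) representation_ne_zero[of B "f c" c] by blast
      ultimately show ?thesis by simp
    qed
    moreover have "span C = ?K (Suc k)"
      using C sub span_minimal by blast
    ultimately show ?case using C(3) by blast
  qed
  from this[of n] obtain B where "independent B" "span B = UNIV" "\<forall>b\<in>B. representation B (f b) b = 0"
    using nil by auto
  then show ?thesis
    by (simp add: lin_trace_eq[OF fd f])
qed

text \<open>
  The diagonal blocks with respect to the base, \<open>b\<close>, \<open>\<xi>\<close> and \<open>e\<^sub>0\<close>.
\<close>

lemma lin_trace_extension:
  fixes f :: "('v::real_vector \<times> real \<times> real) \<times> real \<Rightarrow> ('v \<times> real \<times> real) \<times> real"
  assumes fd: "finite_dim TYPE('v)" and f: "linear f"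
  shows "lin_trace f = lin_trace (\<lambda>x. fst (fst (f ((x, 0, 0), 0)))) +
    fst (snd (fst (f ((0, 1, 0), 0)))) + snd (snd (fst (f ((0, 0, 1), 0)))) + snd (f ((0, 0, 0), 1))"
proof -
  note fdrr = finite_dim_prod[OF finite_dim_real finite_dim_real]
  have comp: "linear (\<lambda>x. fst (k x))" "linear (\<lambda>x. snd (k x))"
    if "linear k" for k :: "'a::real_vector \<Rightarrow> 'b::real_vector \<times> 'c::real_vector"
    by (intro linearI; simp add: linear_add[OF that] linear_cmul[OF that])+
  have f_comp: "linear (\<lambda>x. f (i x))" if "linear i" for i :: "'a::real_vector \<Rightarrow> _"
    using linear_compose[OF that f] by (simp add: o_def)
  have l: "linear (\<lambda>u. fst (f (u, 0)))" "linear (\<lambda>r. snd (f (0, r)))"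
    "linear (\<lambda>p. snd (fst (f ((0, p), 0))))" "linear (\<lambda>s. fst (snd (fst (f ((0, s, 0), 0)))))"
    "linear (\<lambda>t. snd (snd (fst (f ((0, 0, t), 0)))))"
    by (intro comp f_comp; intro linearI; simp)+
  show ?thesis
    by (simp add: lin_trace_prod[OF finite_dim_prod[OF fd fdrr] finite_dim_real f]
        lin_trace_prod[OF fd fdrr l(1)] lin_trace_prod[OF finite_dim_real finite_dim_real l(3)]
        lin_trace_real l l[unfolded zero_prod_def] zero_prod_def)
qed

section \<open>The Ricci tensor of a metric Lie algebra\<close>

locale metric_lie_algebra =
  fixes br :: "'v::real_vector \<Rightarrow> 'v \<Rightarrow> 'v" and g :: "'v \<Rightarrow> 'v \<Rightarrow> real"
  assumes lie: "lie_algebra br" and metric: "lie_metric g"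
begin

abbreviation "nabla \<equiv> levi_civita br g"
abbreviation "R \<equiv> curvature br g"

lemma fd: "finite_dim TYPE('v)"
  using lie unfolding lie_algebra_def by blast

lemma br_bilinear: "bilinear br"
  using lie unfolding lie_algebra_def by blast

lemma g_bilinear: "bilinear g"
  using metric unfolding lie_metric_def by blast

lemma nabla_bilinear: "bilinear nabla"
  by (rule levi_civita_bilinear[OF lie metric])

lemma g_commute: "g x y = g y x"
  using metric unfolding lie_metric_def by blast

lemma linear_bilinear:
  assumes "bilinear b"
  shows "linear (\<lambda>x. b x y)" "linear (b x)"
  using assms unfolding bilinear_def by (auto simp: eta_contract_eq)

lemmas bilinear_rules =
  bilinear_ladd[OF br_bilinear] bilinear_radd[OF br_bilinear] bilinear_lsub[OF br_bilinear]
  bilinear_rsub[OF br_bilinear] bilinear_lmul[OF br_bilinear] bilinear_rmul[OF br_bilinear]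
  bilinear_lneg[OF br_bilinear] bilinear_rneg[OF br_bilinear] bilinear_lzero[OF br_bilinear]
  bilinear_rzero[OF br_bilinear]
  bilinear_ladd[OF g_bilinear] bilinear_radd[OF g_bilinear] bilinear_lsub[OF g_bilinear]
  bilinear_rsub[OF g_bilinear] bilinear_lmul[OF g_bilinear] bilinear_rmul[OF g_bilinear]
  bilinear_lneg[OF g_bilinear] bilinear_rneg[OF g_bilinear] bilinear_lzero[OF g_bilinear]
  bilinear_rzero[OF g_bilinear]
  bilinear_ladd[OF nabla_bilinear] bilinear_radd[OF nabla_bilinear] bilinear_lsub[OF nabla_bilinear]
  bilinear_rsub[OF nabla_bilinear] bilinear_lmul[OF nabla_bilinear] bilinear_rmul[OF nabla_bilinear]
  bilinear_lneg[OF nabla_bilinear] bilinear_rneg[OF nabla_bilinear] bilinear_lzero[OF nabla_bilinear]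
  bilinear_rzero[OF nabla_bilinear]

lemma torsion_free: "nabla x y = nabla y x + br x y"
  using levi_civita_torsion[OF lie metric, of x y] by (simp add: algebra_simps)

lemma br_skew: "br x y = - br y x"
  by (rule lie_algebra_skew[OF lie])

lemma jacobi: "br x (br y z) + br y (br z x) + br z (br x y) = 0"
  using lie unfolding lie_algebra_def by blast

lemma nabla_skew: "g (nabla x y) z = - g y (nabla x z)"
  using levi_civita_metric[OF lie metric, of x y z] by simp

lemma koszul: "2 * g (nabla x y) z = g (br x y) z - g (br y z) x + g (br z x) y"
  by (rule levi_civita_koszul[OF lie metric])

lemma curvature_eq: "R x y z = nabla x (nabla y z) - nabla y (nabla x z) - nabla (br x y) z"
  by (simp add: curvature_def Let_def)

lemma linear_curvature: "linear (\<lambda>x. R x y z)" "linear (R x y)"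
  by (auto intro!: linearI simp: curvature_eq bilinear_rules algebra_simps)

text \<open>
  By torsion-freeness \<open>x \<mapsto> \<nabla>\<^sub>x w\<close> differs from \<open>- ad w\<close> by the skew map \<open>\<nabla>\<^sub>w\<close>.
\<close>

lemma trace_nabla: "lin_trace (\<lambda>x. nabla x w) = - lin_trace (br w)"
proof -
  have "lin_trace (nabla w) = 0"
    by (rule lin_trace_skew[OF fd metric linear_bilinear(2)[OF nabla_bilinear]]) (simp add: nabla_skew)
  moreover have "(\<lambda>x. nabla x w) = (\<lambda>x. nabla w x - br w x)"
    using torsion_free[of _ w] br_skew[of w] by auto
  ultimately show ?thesis
    by (simp add: lin_trace_diff[OF fd] linear_bilinear nabla_bilinear br_bilinear)
qed

text \<open>
  Let \<open>N\<^sub>z x = \<nabla>\<^sub>x z\<close>.  Writing \<open>[x, y] = \<nabla>\<^sub>x y - \<nabla>\<^sub>y x\<close> in the curvature produces the commutator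
  \<open>N\<^sub>z \<nabla>\<^sub>y - \<nabla>\<^sub>y N\<^sub>z\<close>, whose trace is zero, and the remaining terms are \<open>- N\<^sub>z N\<^sub>y\<close> and \<open>x \<mapsto> \<nabla>\<^sub>x (\<nabla>\<^sub>y z)\<close>.
\<close>

lemma ricci_eq:
  "ricci br g y z = - lin_trace (\<lambda>x. nabla (nabla x y) z) - lin_trace (br (nabla y z))"
proof -
  have l: "linear (\<lambda>x. nabla x (nabla y z))" "linear (\<lambda>x. nabla y (nabla x z))"
    "linear (\<lambda>x. nabla (nabla x y) z)" "linear (\<lambda>x. nabla (nabla y x) z)"
    by (auto intro!: linearI simp: bilinear_rules)
  have "R x y z = nabla x (nabla y z) - nabla y (nabla x z) - (nabla (nabla x y) z - nabla (nabla y x) z)" for x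
    using levi_civita_torsion[OF lie metric, of x y]
    by (simp add: curvature_eq flip: bilinear_lsub[OF nabla_bilinear])
  then have "ricci br g y z = lin_trace (\<lambda>x. nabla x (nabla y z)) - lin_trace (\<lambda>x. nabla y (nabla x z))
      - (lin_trace (\<lambda>x. nabla (nabla x y) z) - lin_trace (\<lambda>x. nabla (nabla y x) z))"
    by (simp add: ricci_def lin_trace_diff[OF fd] linear_compose_sub l)
  moreover have "lin_trace (\<lambda>x. nabla y (nabla x z)) = lin_trace (\<lambda>x. nabla (nabla y x) z)"
    by (rule lin_trace_commute[OF fd fd]) (simp_all add: linear_bilinear nabla_bilinear)
  ultimately show ?thesis by (simp add: trace_nabla)
qed

lemma curvature_skew: "R x y z = - R y x z"
  by (simp add: curvature_eq br_skew[of x y] bilinear_rules)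

lemma curvature_skew_metric: "g (R x y z) w = - g (R x y w) z"
  using nabla_skew[of x "nabla y z" w] nabla_skew[of y z "nabla x w"]
    nabla_skew[of y "nabla x z" w] nabla_skew[of x z "nabla y w"] nabla_skew[of "br x y" z w]
    g_commute[of _ z]
  by (simp add: curvature_eq bilinear_rules)

lemma bianchi: "R x y z + R y z x + R z x y = 0"
proof -
  have *: "nabla x (nabla y z) = nabla x (nabla z y) + nabla (br y z) x + br x (br y z)" for x y z
    using torsion_free[of x "br y z"] by (subst torsion_free[of y z]) (simp add: bilinear_rules)
  show ?thesis
    using jacobi[of x y z]
    by (simp add: curvature_eq *[of x y z] *[of y z x] *[of z x y])
qed

lemma curvature_pair_symmetry: "g (R x y z) w = g (R z w x) y"
proof -
  have a: "g (R x y z) w = - g (R y x z) w" for x y z w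
    by (subst curvature_skew) (simp add: bilinear_rules)
  note b = curvature_skew_metric
  have c: "g (R x y z) w + g (R y z x) w + g (R z x y) w = 0" for x y z w
    using arg_cong[OF bianchi[of x y z], of "\<lambda>u. g u w"] by (simp add: bilinear_rules)
  show ?thesis
    using c[of x y z w] c[of y z w x] c[of z w x y] c[of w x y z]
      b[of y z w x] b[of z w y x] b[of w x z y] b[of x y w z]
      a[of z x y w] b[of x z y w] a[of w y z x] b[of y w z x]
    by linarith
qed

lemma ricci_commute: "ricci br g y z = ricci br g z y"
  unfolding ricci_def
proof (rule lin_trace_adjoint[OF fd metric linear_curvature(1)])
  fix x w
  show "g (R x y z) w = g x (R w z y)"
    using curvature_pair_symmetry[of x y z w] curvature_skew[of z w x]
      curvature_skew_metric[of w z x y] g_commute[of x "R w z y"]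
    by (simp add: bilinear_rules)
qed

lemma lower_central_br_power:
  "(br x ^^ k) y \<in> lower_central br k"
  by (induction k) (auto intro!: span_base)

lemma trace_ad_nilpotent:
  assumes "nilpotent br"
  shows "lin_trace (br x) = 0"
proof -
  obtain n where "lower_central br n = {0}"
    using assms unfolding nilpotent_def by blast
  then have "(br x ^^ n) y = 0" for y
    using lower_central_br_power[of n x y] by simp
  then show ?thesis
    by (rule lin_trace_nilpotent[OF fd linear_bilinear(2)[OF br_bilinear]])
qed

end

section \<open>Ricci-flatness of nilpotent pseudo-Kaehler Lie algebras\<close>

locale pseudo_kaehler_algebra =
  fixes br :: "'v::real_vector \<Rightarrow> 'v \<Rightarrow> 'v" and g :: "'v \<Rightarrow> 'v \<Rightarrow> real"
    and J :: "'v \<Rightarrow> 'v" and \<omega> :: "'v \<Rightarrow> 'v \<Rightarrow> real"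
  assumes kaehler: "pseudo_kaehler br g J \<omega>"

sublocale pseudo_kaehler_algebra \<subseteq> metric_lie_algebra br g
  using kaehler unfolding pseudo_kaehler_def by unfold_locales auto

context pseudo_kaehler_algebra
begin

lemma J_linear: "linear J" and J_J: "J (J x) = - x" and g_J_J: "g (J x) (J y) = g x y"
  and omega: "\<omega> x y = g x (J y)"
  using kaehler unfolding pseudo_kaehler_def kaehler_form_def by auto

lemmas J_simps = linear_add[OF J_linear] linear_diff[OF J_linear] linear_neg[OF J_linear]
  linear_cmul[OF J_linear] linear_0[OF J_linear] J_J

lemma J_skew: "g (J x) y = - g x (J y)"
  using g_J_J[of x "J y"] by (simp add: J_J bilinear_rules)

lemma nijenhuis_zero: "br (J x) (J y) = J (br (J x) y) + J (br x (J y)) + br x y"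
  using kaehler unfolding pseudo_kaehler_def nijenhuis_def by (simp add: algebra_simps)

lemma kaehler_cyclic: "g (br x y) (J z) + g (br y z) (J x) + g (br z x) (J y) = 0"
proof -
  have "d2 br \<omega> x y z = 0"
    using kaehler unfolding pseudo_kaehler_def by blast
  then show ?thesis
    using br_skew[of x z] by (simp add: d2_def omega bilinear_rules)
qed

text \<open>
  The classical fact that on a Kaehler manifold \<open>J\<close> is parallel.  The Koszul formula turns the
  claim into a combination of \<open>d\<omega>\<close> on \<open>(x, y, z)\<close> and \<open>(x, J y, J z)\<close> and the Nijenhuis tensor
  of \<open>(y, z)\<close>.
\<close>

lemma nabla_J: "nabla x (J y) = J (nabla x y)"
proof (rule metric_cancel[OF metric])
  fix z
  have "g (br (J y) (J z)) (J x) = g (br (J y) z) x + g (br y (J z)) x + g (br y z) (J x)"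
    by (simp add: nijenhuis_zero[of y z] bilinear_rules g_J_J)
  then show "g (nabla x (J y)) z = g (J (nabla x y)) z"
    using koszul[of x "J y" z] koszul[of x y "J z"] kaehler_cyclic[of x y z]
      kaehler_cyclic[of x "J y" "J z"] J_skew[of "nabla x y" z]
      g_commute[of _ x] g_commute[of _ y] g_commute[of _ z]
    by (simp add: J_J bilinear_rules)
qed

lemma curvature_J: "R x y (J z) = J (R x y z)"
  by (simp add: curvature_eq nabla_J J_simps)

text \<open>
  Pair symmetry transfers \<open>R(u, v) J = J R(u, v)\<close> to the first two slots:
  \<open>R(J x, J y) = R(x, y)\<close>.
\<close>

lemma ricci_J_J: "ricci br g (J y) (J z) = ricci br g y z"
proof -
  have inv: "R (J x) (J y) z = R x y z" for x y z
  proof (rule metric_cancel[OF metric])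
    fix w
    show "g (R (J x) (J y) z) w = g (R x y z) w"
      using curvature_pair_symmetry[of "J x" "J y" z w] curvature_pair_symmetry[of x y z w]
      by (simp add: curvature_J g_J_J)
  qed
  have "lin_trace (\<lambda>x. J (R x (J y) z)) = lin_trace (\<lambda>x. R (J x) (J y) z)"
    by (rule lin_trace_commute[OF fd fd J_linear linear_curvature(1)])
  then show ?thesis by (simp add: ricci_def curvature_J inv)
qed

text \<open>
  The trace of the Bianchi identity composed with \<open>J\<close> expresses \<open>ric(y, J z) - ric(z, J y)\<close> by
  \<open>J R(y, z)\<close>, and \<open>ric(z, J y) = - ric(y, J z)\<close> by invariance under \<open>J\<close>.
\<close>

lemma ricci_form: "2 * ricci br g y (J z) = - lin_trace (\<lambda>x. J (R y z x))"
proof -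
  have l: "linear (\<lambda>x. J (R x z y))" "linear (\<lambda>x. J (R y z x))"
    using linear_compose[OF linear_curvature(1) J_linear] linear_compose[OF linear_curvature(2) J_linear]
    by (simp_all add: o_def)
  have "R x y z = R x z y - R y z x" for x
    using bianchi[of x y z] curvature_skew[of z x y] by (simp add: algebra_simps eq_neg_iff_add_eq_0)
  then have "ricci br g y (J z) = ricci br g z (J y) - lin_trace (\<lambda>x. J (R y z x))"
    by (simp add: ricci_def curvature_J J_simps lin_trace_diff[OF fd l])
  moreover have "ricci br g z (J y) = - ricci br g y (J z)"
  proof -
    have "ricci br g z (J y) = ricci br g (J z) (J (J y))"
      by (rule ricci_J_J[symmetric])
    also have "\<dots> = - ricci br g (J z) y"
      using lin_trace_uminus[OF fd linear_curvature(1), of "J z" y]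
      by (simp add: J_J ricci_def curvature_eq bilinear_rules algebra_simps)
    finally show ?thesis by (simp add: ricci_commute)
  qed
  ultimately show ?thesis by simp
qed

text \<open>
  The map \<open>u + i v \<mapsto> u + J v\<close> from the complexified Lie algebra onto \<open>'v\<close>, whose kernel is the
  \<open>(0, 1)\<close> part, intertwines \<open>ad (x + i J x)\<close> with \<open>ad x + J ad (J x)\<close>, by integrability of \<open>J\<close>.
  Hence powers of the latter map into \<open>C\<^sub>k + J C\<^sub>k\<close>, for \<open>C\<^sub>k\<close> the lower central series, although
  \<open>C\<^sub>k\<close> need not be invariant under \<open>J\<close>.
\<close>

lemma holomorphic_ad_power:
  "\<exists>u\<in>lower_central br k. \<exists>v\<in>lower_central br k. ((\<lambda>y. br x y + J (br (J x) y)) ^^ k) y = u + J v"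
proof (induction k)
  case 0
  show ?case by (rule bexI[of _ y], rule bexI[of _ 0]) (simp_all add: J_simps)
next
  case (Suc k)
  then obtain u v where uv: "u \<in> lower_central br k" "v \<in> lower_central br k"
    "((\<lambda>y. br x y + J (br (J x) y)) ^^ k) y = u + J v"
    by blast
  have mem: "br a b \<in> lower_central br (Suc k)" if "b \<in> lower_central br k" for a b
    using that by (auto intro: span_base)
  have "br x (J v) + J (br (J x) (J v)) = - br (J x) v + J (br x v)"
    by (simp add: nijenhuis_zero J_simps)
  then have "((\<lambda>y. br x y + J (br (J x) y)) ^^ Suc k) y
      = (br x u - br (J x) v) + J (br x v + br (J x) u)"
    using uv(3) by (simp add: bilinear_rules J_simps algebra_simps)
  moreover have "br x u - br (J x) v \<in> lower_central br (Suc k)"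
    "br x v + br (J x) u \<in> lower_central br (Suc k)"
    using mem[OF uv(1)] mem[OF uv(2)] by (simp_all add: span_add span_diff)
  ultimately show ?case by blast
qed

lemma trace_J_ad_nilpotent:
  assumes "nilpotent br"
  shows "lin_trace (\<lambda>y. J (br x y)) = 0"
proof -
  have l: "linear (br x)" "linear (\<lambda>y. J (br x y))" for x
    using linear_bilinear(2)[OF br_bilinear] linear_compose[OF _ J_linear, of "br x"]
    by (simp_all add: o_def)
  obtain n where "lower_central br n = {0}"
    using assms unfolding nilpotent_def by blast
  then have "((\<lambda>y. br x y + J (br (J x) y)) ^^ n) y = 0" for x y
    using holomorphic_ad_power[of n x y] by (auto simp: J_simps)
  then have "lin_trace (\<lambda>y. br x y + J (br (J x) y)) = 0" for x
    by (rule lin_trace_nilpotent[OF fd linear_compose_add[OF l]])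
  from this[of "J x"] show ?thesis
    by (simp add: lin_trace_diff[OF fd] l trace_ad_nilpotent[OF assms] J_simps bilinear_rules)
qed

lemma trace_J_nabla:
  assumes "nilpotent br"
  shows "lin_trace (\<lambda>x. J (nabla x w)) = 0"
  using trace_nabla[of "J w"] by (simp add: nabla_J trace_ad_nilpotent[OF assms])

text \<open>
  As \<open>J\<close> is parallel, the trace of \<open>J [\<nabla>\<^sub>y, \<nabla>\<^sub>z]\<close> is that of the commutator of \<open>\<nabla>\<^sub>y\<close> and \<open>J \<nabla>\<^sub>z\<close>,
  which is zero.  This leaves the term \<open>J \<nabla>\<^sub>w\<close> with \<open>w = [y, z]\<close>, which is traceless for every \<open>w\<close>.
\<close>

theorem ricci_flat_nilpotent:
  assumes "nilpotent br"
  shows "ricci br g y z = 0"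
proof -
  have tJ: "lin_trace (\<lambda>x. J (nabla w x)) = 0" for w
  proof -
    have l: "linear (\<lambda>x. J (nabla x w))" "linear (\<lambda>x. J (br w x))"
      by (auto intro!: linearI simp: bilinear_rules J_simps)
    have "J (nabla w x) = J (nabla x w) + J (br w x)" for x
      by (subst torsion_free) (simp add: J_simps)
    then show ?thesis
      by (simp add: lin_trace_add[OF fd l] trace_J_nabla[OF assms] trace_J_ad_nilpotent[OF assms])
  qed
  have "lin_trace (\<lambda>x. J (R y z x)) = 0" for y z
  proof -
    have l: "linear (nabla y)" "linear (\<lambda>x. J (nabla z x))" "linear (\<lambda>x. J (nabla y (nabla z x)))"
      "linear (\<lambda>x. J (nabla z (nabla y x)))" "linear (\<lambda>x. J (nabla (br y z) x))"
      by (auto intro!: linearI simp: bilinear_rules J_simps)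
    have "lin_trace (\<lambda>x. nabla y (J (nabla z x))) = lin_trace (\<lambda>x. J (nabla z (nabla y x)))"
      by (rule lin_trace_commute[OF fd fd l(1,2)])
    then show ?thesis
      by (simp add: curvature_eq J_simps lin_trace_diff[OF fd] linear_compose_sub l nabla_J tJ)
  qed
  then have "ricci br g y (J (J z)) = 0"
    using ricci_form[of y "J z"] by simp
  then show ?thesis
    using lin_trace_uminus[OF fd linear_curvature(1), of y z]
    by (simp add: J_J ricci_def curvature_eq bilinear_rules algebra_simps)
qed

end

section \<open>The Levi-Civita connection and Ricci tensor of the extension\<close>

locale kaehler_extension = pseudo_kaehler_algebra br g J \<omega>
  for br :: "'v::real_vector \<Rightarrow> 'v \<Rightarrow> 'v" and g J \<omega> +
  fixes D :: "'v \<Rightarrow> 'v" and \<tau> h :: real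
  assumes nil: "nilpotent br" and der: "derivation br D" and tau: "\<tau> = 1 \<or> \<tau> = -1"
    and JD: "J \<circ> D = D \<circ> J"
    and commutator: "\<And>x. sym_part g D (skew_part g D x) - skew_part g D (sym_part g D x)
              = h *\<^sub>R sym_part g D x - 2 *\<^sub>R sym_part g D (sym_part g D x)"
begin

abbreviation "S \<equiv> sym_part g D"
abbreviation "A \<equiv> skew_part g D"
abbreviation "ebr \<equiv> semidirect_bracket (ext_bracket br \<omega> D \<tau>) (ext_deriv D h \<tau>)"
abbreviation "eg \<equiv> semidirect_metric (ext_metric g \<tau>) \<tau>"

lemma D_linear: "linear D"
  using der unfolding derivation_def by blast

lemma D_J: "D (J x) = J (D x)"
  using JD by (metis comp_apply)

lemma D_eq: "D x = S x + A x"
  by (simp add: sym_part_def skew_part_def flip: scaleR_add_right)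

lemma adjoint_D: "g (metric_adjoint g D x) y = g x (D y)"
  by (rule metric_adjoint[OF fd metric D_linear])

lemma g_S: "g (S x) y = g x (S y)"
  using adjoint_D[of x y] adjoint_D[of y x] g_commute[of "D x" y]
    g_commute[of x "metric_adjoint g D y"] by (simp add: sym_part_def bilinear_rules)

lemma g_A: "g (A x) y = - g x (A y)"
  using adjoint_D[of x y] adjoint_D[of y x] g_commute[of "D x" y]
    g_commute[of x "metric_adjoint g D y"] by (simp add: skew_part_def bilinear_rules field_simps)

lemma S_linear: "linear S"
  by (rule linearI; rule metric_cancel[OF metric]) (simp_all add: g_S bilinear_rules)

lemma A_linear: "linear A"
  by (rule linearI; rule metric_cancel[OF metric]) (simp_all add: g_A bilinear_rules)

lemma S_J: "S (J x) = J (S x)"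
proof (rule metric_cancel[OF metric])
  fix y
  show "g (S (J x)) y = g (J (S x)) y"
    using adjoint_D[of "J x" y] adjoint_D[of x "J y"]
    by (simp add: sym_part_def D_J bilinear_rules J_simps J_skew)
qed

lemma trace_D: "lin_trace D = lin_trace S"
proof -
  have "lin_trace A = 0"
    by (rule lin_trace_skew[OF fd metric A_linear]) (simp add: g_A)
  moreover have "lin_trace (\<lambda>x. D x) = lin_trace (\<lambda>x. S x + A x)"
    by (rule arg_cong[where f = lin_trace]) (rule ext, rule D_eq)
  ultimately show ?thesis
    using lin_trace_add[OF fd S_linear A_linear] by simp
qed

lemma tau_tau: "\<tau> * \<tau> = 1" "\<tau> * (\<tau> * c) = c"
  using tau by auto

lemmas D_simps = linear_add[OF D_linear] linear_cmul[OF D_linear] linear_0[OF D_linear]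
lemmas S_simps = linear_add[OF S_linear] linear_cmul[OF S_linear] linear_0[OF S_linear]
lemmas A_simps = linear_add[OF A_linear] linear_cmul[OF A_linear] linear_0[OF A_linear]

lemma g_S_J_skew: "g (S x) (J y) = - g (S y) (J x)"
  using J_skew[of "S x" y] g_S[of "J x" y] g_commute[of "J x" "S y"] by (simp add: S_J)

lemma act2_D: "act2 D \<omega> x y = - 2 * g (S x) (J y)"
  using adjoint_D[of x "J y"] by (simp add: act2_def omega sym_part_def D_J bilinear_rules)

lemma ext_bracket_eq:
  "ebr ((x, s, t), r) ((y, s', t'), r') =
    ((br x y + r *\<^sub>R D y - r' *\<^sub>R D x,
      2 * \<tau> * g (S x) (J y) + h * (r * s' - r' * s),
      - 2 * g x (J y) - 2 * \<tau> * (r * s' - r' * s)), 0)"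
  by (simp add: act2_D omega algebra_simps)

lemma ext_lie_algebra: "lie_algebra ebr"
  by (rule lie_algebra_semidirect)
    (rule lie_algebra_ext[OF kaehler der tau JD commutator]
      derivation_ext[OF kaehler der tau JD commutator])+

lemma ext_lie_metric: "lie_metric eg"
  by (rule metric_tilde[OF metric tau])

sublocale ext: metric_lie_algebra ebr eg
  by unfold_locales (rule ext_lie_algebra ext_lie_metric)+

text \<open>
  Both sides satisfy the Koszul formula of the extension.
\<close>

lemma ext_nabla:
  "ext.nabla ((x, s, t), r) ((y, s', t'), r') =
    ((nabla x y + s' *\<^sub>R S (J x) + s *\<^sub>R S (J y) - t' *\<^sub>R J x - t *\<^sub>R J y - r' *\<^sub>R S x + r *\<^sub>R A y,
      \<tau> * g (S x) (J y) - h * s * r' + t * r' + r * t',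
      - g x (J y) + \<tau> * s * r' - \<tau> * r * s'),
     \<tau> * g (S x) y + h * s * s' - s * t' - t * s')"
  (is "ext.nabla ?u ?v = ?n")
proof (rule metric_cancel[OF ext_lie_metric])
  fix w :: "('v \<times> real \<times> real) \<times> real"
  obtain z s'' t'' r'' where w: "w = ((z, s'', t''), r'')" by (metis prod.exhaust)
  have n: "g (nabla x y) z = (g (br x y) z - g (br y z) x + g (br z x) y) / 2"
    using koszul[of x y z] by simp
  have gA: "g (A x) y = - g (A y) x" "g (A y) z = - g (A z) y" "g (A z) x = - g (A x) z"
    using g_A g_commute by metis+
  have gS: "g (S y) x = g (S x) y" "g (S z) x = g (S x) z" "g (S z) y = g (S y) z"
    using g_S g_commute by metis+
  have gJ: "g y (J x) = - g x (J y)" "g z (J x) = - g x (J z)" "g z (J y) = - g y (J z)"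
    "g (J x) z = - g x (J z)" "g (J y) z = - g y (J z)"
    using J_skew g_commute by (metis neg_equal_iff_equal add.inverse_inverse)+
  have gSJ: "g (S y) (J x) = - g (S x) (J y)" "g (S z) (J x) = - g (S x) (J z)"
    "g (S z) (J y) = - g (S y) (J z)" "g (S (J x)) z = - g (S x) (J z)" "g (S (J y)) z = - g (S y) (J z)"
    using g_S_J_skew[of y x] g_S_J_skew[of z x] g_S_J_skew[of z y] by (simp_all add: S_J J_skew)
  \<comment> \<open>In the normal form used here, the arguments of \<open>g\<close> are alphabetical, and \<open>S\<close>, \<open>A\<close> stand left and \<open>J\<close> right.\<close>
  have "2 * eg ?n w = eg (ebr ?u ?v) w - eg (ebr ?v w) ?u + eg (ebr w ?u) ?v"
    unfolding w ext_bracket_eq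
    by (simp add: D_eq bilinear_rules n gA gS gJ gSJ algebra_simps tau_tau add_divide_distrib diff_divide_distrib)
  then show "eg (ext.nabla ?u ?v) w = eg ?n w"
    using ext.koszul[of ?u ?v w] by simp
qed

text \<open>
  The elements of the nilpotent ideal act with trace zero, so only \<open>e\<^sub>0\<close> contributes.
\<close>

lemma trace_ext_ad: "lin_trace (ebr ((x, s, t), r)) = r * (lin_trace D + h)"
proof -
  have "lin_trace (\<lambda>y. br x y + r *\<^sub>R D y) = r * lin_trace D"
    using linear_bilinear(2)[OF br_bilinear, of x]
    by (simp add: lin_trace_add[OF fd] lin_trace_scaleR[OF fd] D_linear linear_compose_scale_right
        trace_ad_nilpotent[OF nil])
  then show ?thesis
    by (simp add: lin_trace_extension[OF fd ext.linear_bilinear(2)[OF ext.br_bilinear]]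
        ext_bracket_eq bilinear_rules D_simps S_simps J_simps algebra_simps del: semidirect_bracket.simps ext_bracket.simps)
qed

text \<open>
  The block over the base of the endomorphism \<open>v \<mapsto> \<nabla>\<^sub>v (x + s b + t \<xi> + r e\<^sub>0)\<close>.
\<close>

definition nabla_block :: "'v \<Rightarrow> real \<Rightarrow> real \<Rightarrow> real \<Rightarrow> 'v \<Rightarrow> 'v" where
  "nabla_block x s t r w = nabla w x + s *\<^sub>R S (J w) - t *\<^sub>R J w - r *\<^sub>R S w"

lemma linear_nabla_block: "linear (nabla_block x s t r)"
  by (rule linearI) (simp_all add: nabla_block_def bilinear_rules S_simps J_simps algebra_simps)

text \<open>
  In \<open>N\<^sub>v N\<^sub>u\<close> the block over the base is the product of the two blocks plus rank-one terms that
  pass through \<open>b\<close>, \<open>\<xi>\<close> and \<open>e\<^sub>0\<close>.  The rank-one terms and the diagonal entries at \<open>b\<close>, \<open>\<xi>\<close> and \<open>e\<^sub>0\<close> add up to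
  \<open>2 g(x, x') + 2 \<tau> g(S x, S x') + \<tau> (g(S A x, x') + g(S A x', x))\<close> plus terms in the scalars, and the
  commutator hypothesis replaces the last sum by \<open>h g(S x, x') - 2 g(S x, S x')\<close>.
\<close>

lemma ext_ricci:
  "ricci ebr eg ((x, s, t), r) ((x', s', t'), r') =
    - lin_trace (\<lambda>w. nabla_block x' s' t' r' (nabla_block x s t r w))
    - 2 * g x x' - \<tau> * (lin_trace D + 2 * h) * g (S x) x'
    - (h * (lin_trace D + h) + 2 * \<tau>) * (s * s') + lin_trace D * (s * t' + s' * t) + 2 * (t * t')
    - (h\<^sup>2 + 2 * \<tau>) * (r * r')"
proof -
  let ?u = "((x, s, t), r)" and ?v = "((x', s', t'), r')"
  let ?E = "nabla_block x s t r" and ?E' = "nabla_block x' s' t' r'"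
  have lN: "linear (\<lambda>w. ext.nabla (ext.nabla w ?u) ?v)"
    by (intro linearI) (simp_all add: ext.bilinear_rules)
  have p: "linear (\<lambda>w. \<tau> * g (S w) (J x))" "linear (\<lambda>w. g w (J x))" "linear (\<lambda>w. \<tau> * g (S w) x)"
    by (auto intro!: linearI simp: bilinear_rules S_simps algebra_simps)
  have lr: "linear (\<lambda>w. k w *\<^sub>R c)" if "linear k" for k :: "'v \<Rightarrow> real" and c :: 'v
    by (intro linearI) (simp_all add: linear_add[OF that] linear_cmul[OF that] scaleR_add_left)
  have gJx: "g (S (S (J x'))) (J x) = g (S x) (S x')" "g (S (S (J x))) (J x') = g (S x) (S x')"
    "g (J x') (J x) = g x x'"
    "g (S x') x = g (S x) x'"
    using g_commute[of "S x"] g_commute[of x x'] g_S[of "S x'" x] g_commute[of "S x'" x]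
    by (simp_all add: S_J g_J_J g_S)
  have gSA: "g (S (A x)) x' = h * g (S x) x' - 2 * g (S x) (S x') - g (S (A x')) x"
  proof -
    have "g (S (A x)) x' - g (A (S x)) x' = h * g (S x) x' - 2 * g (S x) (S x')"
      using arg_cong[OF commutator[of x], of "\<lambda>z. g z x'"] by (simp add: bilinear_rules g_S)
    moreover have "g (A (S x)) x' = - g (S (A x')) x"
      using g_A[of "S x" x'] g_S[of x "A x'"] g_S[of "A x'" x] g_commute[of "A x'" "S x"] by simp
    ultimately show ?thesis by simp
  qed
  have "lin_trace (\<lambda>w. fst (fst (ext.nabla (ext.nabla ((w, 0, 0), 0) ?u) ?v)))
    = lin_trace (\<lambda>w. ?E' (?E w)
      + (\<tau> * g (S w) (J x)) *\<^sub>R S (J x') + g w (J x) *\<^sub>R J x' + (\<tau> * g (S w) x) *\<^sub>R A x')"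
    by (simp add: ext_nabla nabla_block_def bilinear_rules S_simps J_simps algebra_simps)
  also have "\<dots>
    = lin_trace (\<lambda>w. ?E' (?E w)) + \<tau> * g (S (S (J x'))) (J x) + g (J x') (J x) + \<tau> * g (S (A x')) x"
    using linear_compose[OF linear_nabla_block[of x s t r] linear_nabla_block[of x' s' t' r']]
    by (simp add: o_def lin_trace_add[OF fd] linear_compose_add lr[OF p(1)] lr[OF p(2)] lr[OF p(3)]
        lin_trace_rank_one[OF fd p(1)] lin_trace_rank_one[OF fd p(2)] lin_trace_rank_one[OF fd p(3)])
  finally have base: "lin_trace (\<lambda>w. fst (fst (ext.nabla (ext.nabla ((w, 0, 0), 0) ?u) ?v))) = \<dots>" .
  have b: "fst (snd (fst (ext.nabla (ext.nabla ((0, 1, 0), 0) ?u) ?v)))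
      = \<tau> * g (S x) (S x') + h\<^sup>2 * (r * r') + \<tau> * (r * r') + (h * s - t) * t'"
    by (simp add: ext_nabla bilinear_rules S_simps J_simps A_simps gJx power2_eq_square algebra_simps)
  have xi: "snd (snd (fst (ext.nabla (ext.nabla ((0, 0, 1), 0) ?u) ?v))) = g x x' + \<tau> * (r * r') + \<tau> * (s * s')"
    by (simp add: ext_nabla bilinear_rules S_simps J_simps A_simps gJx g_J_J algebra_simps)
  have e0: "snd (ext.nabla (ext.nabla ((0, 0, 0), 1) ?u) ?v)
      = \<tau> * g (S (A x)) x' + h * t * s' - t * t' + \<tau> * (s * s')"
    by (simp add: ext_nabla bilinear_rules S_simps J_simps A_simps gJx g_J_J algebra_simps)
  have ad: "lin_trace (ebr (ext.nabla ?u ?v))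
      = (\<tau> * g (S x) x' + h * s * s' - s * t' - t * s') * (lin_trace D + h)"
    by (simp only: ext_nabla trace_ext_ad)
  show ?thesis
    unfolding ext.ricci_eq lin_trace_extension[OF fd lN] base b xi e0 ad gJx gSA
    by (simp add: power2_eq_square algebra_simps)
qed

section \<open>The Einstein condition\<close>

lemma trace_J: "lin_trace J = 0"
  by (rule lin_trace_skew[OF fd metric J_linear]) (simp add: J_skew)

text \<open>
  As \<open>ad\<close> is traceless on the base, the Ricci tensor of the base is \<open>- tr (N\<^sub>y N\<^sub>x)\<close>, so this trace
  is where Ricci-flatness enters.
\<close>

lemma trace_nabla_nabla: "lin_trace (\<lambda>w. nabla (nabla w x) y) = 0"
  using ricci_eq[of x y] by (simp add: ricci_flat_nilpotent[OF nil] trace_ad_nilpotent[OF nil])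

lemma trace_nabla_J: "lin_trace (\<lambda>w. nabla (J w) x) = 0"
  using lin_trace_commute[OF fd fd linear_bilinear(1)[OF nabla_bilinear] J_linear, of x]
  by (simp add: trace_J_nabla[OF nil])

lemma ext_ricci_base:
  "ricci ebr eg ((x, 0, 0), 0) ((x', 0, 0), 0) = - 2 * g x x' - \<tau> * (lin_trace D + 2 * h) * g (S x) x'"
  by (simp add: ext_ricci nabla_block_def trace_nabla_nabla)

lemma ext_ricci_xi: "ricci ebr eg ((0, 0, 1), 0) ((0, 0, 1), 0) = lin_trace (\<lambda>x::'v. x) + 2"
  using lin_trace_uminus[OF fd linear_ident]
  by (simp add: ext_ricci nabla_block_def bilinear_rules J_simps)

text \<open>
  The direction \<open>\<xi>\<close> fixes the Einstein constant, and the base then determines \<open>S\<close>, unless the base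
  is zero; in that case \<open>e\<^sub>0\<close> determines \<open>h\<close>, and \<open>S = Id = - Id\<close>.
\<close>

lemma sym_part_eq_if_einstein:
  assumes "einstein ebr eg"
  shows "\<tau> = -1 \<and> ((S = (\<lambda>x. x) \<and> h = 2) \<or> (S = (\<lambda>x. - x) \<and> h = -2))"
proof -
  define n where "n = lin_trace (\<lambda>x::'v. x)"
  have n: "n \<ge> 0"
    unfolding n_def by (rule lin_trace_ident_nonneg[OF fd])
  obtain c where c: "\<And>u v. ricci ebr eg u v = c * eg u v"
    using assms unfolding einstein_def by blast
  have c_eq: "c = n + 2"
    using c[of "((0, 0, 1), 0)" "((0, 0, 1), 0)"] by (simp add: ext_ricci_xi bilinear_rules n_def)
  show ?thesis
  proof (cases "\<exists>x::'v. x \<noteq> 0")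
    case True
    then obtain x0 :: 'v where x0: "x0 \<noteq> 0" by blast
    define k where "k = - \<tau> * (lin_trace D + 2 * h)"
    have k: "k *\<^sub>R S x = (n + 4) *\<^sub>R x" for x
    proof (rule metric_cancel[OF metric])
      fix y
      show "g (k *\<^sub>R S x) y = g ((n + 4) *\<^sub>R x) y"
        using c[of "((x, 0, 0), 0)" "((y, 0, 0), 0)"]
        by (simp add: ext_ricci_base c_eq bilinear_rules k_def algebra_simps)
    qed
    have "k \<noteq> 0"
      using k[of x0] x0 n by auto
    define s where "s = (n + 4) / k"
    have S: "S x = s *\<^sub>R x" for x
      using arg_cong[OF k[of x], of "\<lambda>y. (1 / k) *\<^sub>R y"] \<open>k \<noteq> 0\<close> by (simp add: s_def)
    have "s \<noteq> 0"
      using n \<open>k \<noteq> 0\<close> by (simp add: s_def)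
    have "(h * s - 2 * (s * s)) *\<^sub>R x0 = 0"
      using commutator[of x0] by (simp add: S A_simps scaleR_diff_left)
    then have h: "h = 2 * s"
      using x0 \<open>s \<noteq> 0\<close> by simp
    have "lin_trace D = s * n"
      using lin_trace_scaleR[OF fd linear_ident, of s] by (simp add: trace_D S[abs_def] n_def)
    then have "(n + 4) * (- \<tau> * s\<^sup>2) = k * s"
      by (simp add: k_def h power2_eq_square algebra_simps)
    also have "\<dots> = (n + 4) * 1"
      using \<open>k \<noteq> 0\<close> by (simp add: s_def)
    finally have "(n + 4) * (- \<tau> * s\<^sup>2) = (n + 4) * 1" .
    then have ts: "- \<tau> * s\<^sup>2 = 1"
      using n by (simp only: mult_cancel_left) simp
    have "\<tau> \<noteq> 1"
    proof
      assume "\<tau> = 1"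
      then have "s\<^sup>2 = -1" using ts by simp
      then show False using zero_le_power2[of s] by linarith
    qed
    then have "\<tau> = -1" using tau by blast
    moreover from this have "s = 1 \<or> s = -1"
      using ts by (simp add: power2_eq_1_iff)
    ultimately show ?thesis
      using S h by (auto simp: fun_eq_iff)
  next
    case False
    then have triv: "x = 0" for x :: 'v by blast
    have tr0: "lin_trace f = 0" if "linear f" for f :: "'v \<Rightarrow> 'v"
      using lin_trace_nilpotent[OF fd that, of 0] triv by blast
    have "n = 0"
      unfolding n_def by (rule tr0[OF linear_ident])
    have "lin_trace (\<lambda>w. nabla_block 0 0 0 1 (nabla_block 0 0 0 1 w)) = 0"
      using linear_compose[OF linear_nabla_block linear_nabla_block] by (intro tr0) (simp add: o_def)
    then have "- (h\<^sup>2 + 2 * \<tau>) = 2 * \<tau>"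
      using c[of "((0, 0, 0), 1)" "((0, 0, 0), 1)"] by (simp add: ext_ricci c_eq \<open>n = 0\<close> bilinear_rules S_simps)
    then have h: "h\<^sup>2 = - 4 * \<tau>" by simp
    then have "\<tau> = -1"
      using tau zero_le_power2[of h] by auto
    then have "h\<^sup>2 = 2\<^sup>2" using h by simp
    then have "h = 2 \<or> h = -2" by (simp only: power2_eq_iff)
    moreover have "S = (\<lambda>x. x)" "S = (\<lambda>x. - x)"
      using triv by (metis ext)+
    ultimately show ?thesis using \<open>\<tau> = -1\<close> by blast
  qed
qed

text \<open>
  For scalar \<open>S\<close> the product of the blocks is a combination of \<open>N\<^sub>x N\<^sub>y\<close>, \<open>N\<^sub>x\<close>, \<open>J N\<^sub>x\<close>, \<open>N\<^sub>x J\<close>, \<open>J\<close>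
  and the identity, and only the identity has a nonzero trace.
\<close>

lemma einstein_if_sym_part_eq:
  assumes \<tau>: "\<tau> = -1" and S: "\<And>x. S x = \<sigma> *\<^sub>R x" and h: "h = 2 * \<sigma>" and \<sigma>: "\<sigma> * \<sigma> = 1"
  shows "einstein ebr eg"
proof -
  define n where "n = lin_trace (\<lambda>x::'v. x)"
  have lS: "lin_trace D = \<sigma> * n"
    using lin_trace_scaleR[OF fd linear_ident, of \<sigma>] by (simp add: trace_D S[abs_def] n_def)
  have tr: "lin_trace (\<lambda>w. nabla_block x' s' t' r' (nabla_block x s t r w))
      = n * (r * r' - (\<sigma> * s - t) * (\<sigma> * s' - t'))" for x s t r x' s' t' r'
  proof -
    \<comment> \<open>The two blocks are \<open>N\<^sub>x + a J + c Id\<close> and \<open>N\<^sub>x' + a' J + c' Id\<close>.\<close>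
    let ?a = "\<sigma> * s - t" and ?a' = "\<sigma> * s' - t'" and ?c = "- \<sigma> * r" and ?c' = "- \<sigma> * r'"
    have l: "linear (\<lambda>w. nabla (nabla w x) x')" "linear (\<lambda>w. nabla (J w) x')" "linear (\<lambda>w. nabla w x')"
      "linear (\<lambda>w. J (nabla w x))" "linear J" "linear (\<lambda>w. nabla w x)" "linear (\<lambda>w::'v. w)"
      by (auto intro!: linearI simp: bilinear_rules J_simps)
    have "nabla_block x' s' t' r' (nabla_block x s t r w)
      = nabla (nabla w x) x' + ?a *\<^sub>R nabla (J w) x' + ?c *\<^sub>R nabla w x' + ?a' *\<^sub>R J (nabla w x)
        + (?a' * ?c + ?c' * ?a) *\<^sub>R J w + ?c' *\<^sub>R nabla w x + (?c' * ?c - ?a' * ?a) *\<^sub>R w" for w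
      by (simp add: nabla_block_def S bilinear_rules J_simps algebra_simps)
    then have "lin_trace (\<lambda>w. nabla_block x' s' t' r' (nabla_block x s t r w))
      = (?c' * ?c - ?a' * ?a) * n"
      by (simp add: lin_trace_add[OF fd] lin_trace_scaleR[OF fd] l linear_compose_add
          linear_compose_scale_right trace_nabla_nabla trace_nabla_J trace_nabla trace_J
          trace_J_nabla[OF nil] trace_ad_nilpotent[OF nil] n_def del: mult_minus_left scaleR_minus_left)
    moreover have "?c' * ?c = \<sigma> * \<sigma> * (r * r')"
      by (simp add: algebra_simps)
    ultimately show ?thesis
      by (simp add: \<sigma> algebra_simps)
  qed
  have \<sigma>2: "\<sigma> * (\<sigma> * z) = z" for z
    using \<sigma> by (simp flip: mult.assoc)
  have "ricci ebr eg ((x, s, t), r) ((x', s', t'), r') = (n + 2) * eg ((x, s, t), r) ((x', s', t'), r')"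
    for x s t r x' s' t' r'
    unfolding ext_ricci by (simp add: tr lS \<tau> h S bilinear_rules \<sigma> \<sigma>2 power2_eq_square algebra_simps)
  then have "ricci ebr eg u v = (n + 2) * eg u v" for u v
    by (metis prod.exhaust)
  then show ?thesis
    unfolding einstein_def by blast
qed

end

theorem lemma3p3:
  fixes br :: "'v::real_vector \<Rightarrow> 'v \<Rightarrow> 'v"
    and g :: "'v \<Rightarrow> 'v \<Rightarrow> real"
    and J D :: "'v \<Rightarrow> 'v"
    and \<omega> :: "'v \<Rightarrow> 'v \<Rightarrow> real"
    and \<tau> h :: real
  assumes "pseudo_kaehler br g J \<omega>"
    and "nilpotent br"
    and "derivation br D"
    and "\<tau> = 1 \<or> \<tau> = -1"
    and "J \<circ> D = D \<circ> J"
    and "\<And>x. sym_part g D (skew_part g D x) - skew_part g D (sym_part g D x)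
              = h *\<^sub>R sym_part g D x - 2 *\<^sub>R sym_part g D (sym_part g D x)"
  shows "einstein
           (semidirect_bracket (ext_bracket br \<omega> D \<tau>) (ext_deriv D h \<tau>))
           (semidirect_metric (ext_metric g \<tau>) \<tau>)
         \<longleftrightarrow> \<tau> = -1 \<and> ((sym_part g D = (\<lambda>x. x) \<and> h = 2) \<or> (sym_part g D = (\<lambda>x. - x) \<and> h = -2))"
proof -
  interpret kaehler_extension br g J \<omega> D \<tau> h
    using assms by unfold_locales
  show ?thesis
    using sym_part_eq_if_einstein einstein_if_sym_part_eq[of 1] einstein_if_sym_part_eq[of "-1"] by fastforce
qed

end
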